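(* Let $\kappa$ be an infinite cardinal, let $T$ be a $\forall Q^{\text{struct}}$-theory of $\mathbb{L}^{\kappa\text{-struct}}_{\infty,\omega}$ (in some vocabulary $\tau$), and let $\mathcal{F}$ be the smallest fragment containing $T$. Then $\operatorname{Mod}_{\mathcal{F}}(T)$ is an abstract elementary class with intersections and its Löwenheim–Skolem–Tarski number is at most $|\mathcal{F}|+\kappa^-$, where $\kappa^-=\kappa_0$ if $\kappa=\kappa_0^+$ for some cardinal $\kappa_0$, and $\kappa^-=\kappa$ otherwise.
   Context: Structures: vocabularies are finitary; structures are allowed to have empty universe (when the vocabulary has no constant symbols). $|M|$ is the universe of $M$ and $\|M\|$ its cardinality. AEC: an abstract elementary class is a pair $\mathcal{K}=(K,\le_{\mathcal{K}})$ such that: (1) $K$ is a class of structures in a fixed vocabulary $\tau(\mathcal{K})$, $\le_{\mathcal{K}}$ is a partial order on $K$, $M\le_{\mathcal{K}} N$ implies $M\subseteq N$ (substructure), and $K$ and $\le_{\mathcal{K}}$ are closed under isomorphisms; (2) coherence: if $M_0,M_1,M_2\in K$, $M_0\subseteq M_1\le_{\mathcal{K}} M_2$ and $M_0\le_{\mathcal{K}} M_2$, then $M_0\le_{\mathcal{K}} M_1$; (3) Tarski–Vaught chain axioms: if $\delta$ is a limit ordinal, $\langle M_i:i<\delta\rangle$ is $\le_{\mathcal{K}}$-increasing and $M=\bigcup_{i<\delta}M_i$, then $M\in K$, $M_0\le_{\mathcal{K}} M$, and if $N\in K$ satisfies $M_i\le_{\mathcal{K}} N$ for all $i<\delta$ then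 $M\le_{\mathcal{K}} N$; (4) Löwenheim–Skolem–Tarski axiom: there is a cardinal $\lambda\ge|\tau(\mathcal{K})|+\aleph_0$ such that for every $N\in K$ and $A\subseteq|N|$ there is $M\in K$ with $A\subseteq|M|$, $M\le_{\mathcal{K}} N$ and $\|M\|\le|A|+\lambda$. The least such $\lambda$ is $\operatorname{LS}(\mathcal{K})$, the Löwenheim–Skolem–Tarski number. Intersections: for $N\in K$ and $A\subseteq|N|$, $c\ell^N(A)$ is the intersection of all (universes of) $N_0\le_{\mathcal{K}} N$ with $A\subseteq|N_0|$; it is also viewed as the $\tau(\mathcal{K})$-substructure of $N$ with that universe. $\mathcal{K}$ has intersections (is an AEC with intersections) if $c\ell^N(A)\le_{\mathcal{K}} N$ for all $N\in K$ and $A\subseteq|N|$. Structural logic: let $\tau$ be a vocabulary and $\kappa$ an infinite cardinal. $\mathbb{L}^{\kappa\text{-struct}}_{\infty,\omega}(\tau)$ is $\mathbb{L}_{\infty,\omega}(\tau)$ (set-sized conjunctions and disjunctions, finite quantifier strings, finitely many free variables) closed additionally under the following: if $n<\omega$, $\phi(x,\mathbf{z})$ and $\psi_i(y_i,\mathbf{z})$ ($i<n$) are formulas, $\tau_0\subseteq\tau$ is a sub-vocabulary, $M$ is a $\tau_0$-structure whose universe is an ordinal $<\kappa$, and $\mathbf{A}=\langle A_i:i<n\rangle$ are subsets of $|M|$, then, writing $\mathbf{y}=\langle y_i:i<n\rangle$, $Q^{\text{struct}}_{M,\mathbf{A}}\,x\,\mathbf{y}\,\phi(x,\mathbf{z})\langle\psi_i(y_i,\mathbf{z}):i<n\rangle$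 is a formula. Its satisfaction: $N\models Q^{\text{struct}}_{M,\mathbf{A}}\,x\,\mathbf{y}\,\phi(x,\mathbf{b})\langle\psi_i(y_i,\mathbf{b}):i<n\rangle$ iff (i) $N\models\forall x(\psi_i(x,\mathbf{b})\to\phi(x,\mathbf{b}))$ for all $i<n$, and (ii) there is a $\tau_0$-substructure $N_0$ of $N$ with universe $\phi(N,\mathbf{b})$ and an isomorphism $f$ from $N_0$ onto $M$ with $f[\psi_i(N,\mathbf{b})]=A_i$ for all $i<n$. A $\forall Q^{\text{struct}}$-sentence is a sentence of the form $\forall\mathbf{z}\bigvee_{(M,\mathbf{A})\in S}Q^{\text{struct}}_{M,\mathbf{A}}\,x\,\mathbf{y}\,\phi(x,\mathbf{z})\langle\psi_i(y_i,\mathbf{z}):i<n\rangle$ with $\phi$ and the $\psi_i$ quantifier-free and $S$ a non-empty set. A $\forall Q^{\text{struct}}$-theory is a set of $\forall Q^{\text{struct}}$-sentences. Fragments and ordering: a fragment $\mathcal{F}$ is a set of formulas closed under subformulas and containing all atomic formulas (closure under finitary operations is not required). For $\tau$-structures $N_1\subseteq N_2$ and a fragment $\mathcal{F}\subseteq\mathbb{L}^{\kappa\text{-struct}}_{\infty,\omega}(\tau)$, $N_1\preceq_{\mathcal{F}}N_2$ means $N_1\models\phi(\mathbf{a})\iff N_2\models\phi(\mathbf{a})$ for all $\phi\in\mathcal{F}$ and $\mathbf{a}\in N_1$. $N_1\preceq^*_{\mathcal{F}}N_2$ means: $N_1\preceq_{\mathcal{F}}N_2$, and for every formula $Q^{\text{struct}}_{M,\mathbf{A}}\,x\,\mathbf{y}\,\phi(x,\mathbf{z})\langle\psi_i(y_i,\mathbf{z}):i<n\rangle$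 in $\mathcal{F}$ and every $\mathbf{b}\in N_1$, if $|\phi(N_1,\mathbf{b})|<\kappa$ then $\phi(N_1,\mathbf{b})=\phi(N_2,\mathbf{b})$ and $\psi_i(N_1,\mathbf{b})=\psi_i(N_2,\mathbf{b})$ for all $i<n$. For a theory $T\subseteq\mathcal{F}$, $\operatorname{Mod}_{\mathcal{F}}(T)$ is the pair $(\operatorname{Mod}(T),\preceq^*_{\mathcal{F}})$. *)

theory Defs
  imports Main
begin

unbundle cardinal_syntax

section \<open>Vocabularies and structures\<close>

text \<open>A finitary vocabulary is a pair of partial functions: the symbols are the elements of
  the two domains, and the values are their arities. Constants are 0-ary function symbols.\<close>

record ('f, 'r) vocab =
  fun_ar :: "'f \<Rightarrow> nat option"
  rel_ar :: "'r \<Rightarrow> nat option"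

definition sub_vocab :: "('f, 'r) vocab \<Rightarrow> ('f, 'r) vocab \<Rightarrow> bool" where
  "sub_vocab \<tau>0 \<tau> \<longleftrightarrow> fun_ar \<tau>0 \<subseteq>\<^sub>m fun_ar \<tau> \<and> rel_ar \<tau>0 \<subseteq>\<^sub>m rel_ar \<tau>"

text \<open>A structure carries its vocabulary. The universe is a subset of a type, possibly empty.\<close>

record ('f, 'r, 'a) struct =
  voc :: "('f, 'r) vocab"
  univ :: "'a set"
  fn :: "'f \<Rightarrow> 'a list \<Rightarrow> 'a"
  rl :: "'r \<Rightarrow> 'a list \<Rightarrow> bool"

text \<open>The interpretations are required to be trivial outside of their domains, so that equality
  of records is equality of structures (in particular, mutual substructures are equal).\<close>

definition is_struct :: "('f, 'r, 'a) struct \<Rightarrow> bool" where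
  "is_struct M \<longleftrightarrow>
    (\<forall>f xs. fun_ar (voc M) f = Some (length xs) \<and> set xs \<subseteq> univ M \<longrightarrow> fn M f xs \<in> univ M) \<and>
    (\<forall>f xs. \<not> (fun_ar (voc M) f = Some (length xs) \<and> set xs \<subseteq> univ M) \<longrightarrow> fn M f xs = undefined) \<and>
    (\<forall>r xs. rl M r xs \<longrightarrow> rel_ar (voc M) r = Some (length xs) \<and> set xs \<subseteq> univ M)"

definition substruct :: "('f, 'r, 'a) struct \<Rightarrow> ('f, 'r, 'a) struct \<Rightarrow> bool" where
  "substruct M N \<longleftrightarrow>
    is_struct M \<and> is_struct N \<and> voc M = voc N \<and> univ M \<subseteq> univ N \<and>
    (\<forall>f xs. fun_ar (voc M) f = Some (length xs) \<and> set xs \<subseteq> univ M \<longrightarrow> fn M f xs = fn N f xs) \<and>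
    (\<forall>r xs. rel_ar (voc M) r = Some (length xs) \<and> set xs \<subseteq> univ M \<longrightarrow> rl M r xs = rl N r xs)"

definition reduct :: "('f, 'r) vocab \<Rightarrow> ('f, 'r, 'a) struct \<Rightarrow> ('f, 'r, 'a) struct" where
  "reduct \<tau>0 N =
    \<lparr>voc = \<tau>0, univ = univ N,
     fn = (\<lambda>f xs. if f \<in> dom (fun_ar \<tau>0) then fn N f xs else undefined),
     rl = (\<lambda>r xs. r \<in> dom (rel_ar \<tau>0) \<and> rl N r xs)\<rparr>"

text \<open>The restriction of a structure to \<open>B\<close>; it is a substructure of \<open>N\<close> if and only if
  the set \<open>B \<subseteq> univ N\<close> is closed under the functions of \<open>N\<close>.\<close>

definition restrict_struct :: "('f, 'r, 'a) struct \<Rightarrow> 'a set \<Rightarrow> ('f, 'r, 'a) struct" where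
  "restrict_struct N B =
    \<lparr>voc = voc N, univ = B,
     fn = (\<lambda>f xs. if set xs \<subseteq> B then fn N f xs else undefined),
     rl = (\<lambda>r xs. set xs \<subseteq> B \<and> rl N r xs)\<rparr>"

definition is_iso :: "('a \<Rightarrow> 'b) \<Rightarrow> ('f, 'r, 'a) struct \<Rightarrow> ('f, 'r, 'b) struct \<Rightarrow> bool" where
  "is_iso h M N \<longleftrightarrow>
    is_struct M \<and> is_struct N \<and> voc M = voc N \<and> bij_betw h (univ M) (univ N) \<and>
    (\<forall>f xs. fun_ar (voc M) f = Some (length xs) \<and> set xs \<subseteq> univ M \<longrightarrow>
      h (fn M f xs) = fn N f (map h xs)) \<and>
    (\<forall>r xs. rel_ar (voc M) r = Some (length xs) \<and> set xs \<subseteq> univ M \<longrightarrow>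
      rl M r xs = rl N r (map h xs))"

text \<open>The union of the structures \<open>Ms i\<close>, \<open>i \<in> I\<close>, meant for families of structures in the
  vocabulary \<open>\<tau>\<close> that form a chain under \<^const>\<open>substruct\<close>.\<close>

definition union_struct ::
  "('f, 'r) vocab \<Rightarrow> 'o set \<Rightarrow> ('o \<Rightarrow> ('f, 'r, 'a) struct) \<Rightarrow> ('f, 'r, 'a) struct" where
  "union_struct \<tau> I Ms =
    \<lparr>voc = \<tau>, univ = (\<Union>i\<in>I. univ (Ms i)),
     fn = (\<lambda>f xs. if \<exists>i\<in>I. set xs \<subseteq> univ (Ms i)
                   then THE y. \<exists>i\<in>I. set xs \<subseteq> univ (Ms i) \<and> y = fn (Ms i) f xs
                   else undefined),
     rl = (\<lambda>r xs. \<exists>i\<in>I. rl (Ms i) r xs)\<rparr>"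

section \<open>Abstract elementary classes\<close>

text \<open>A class of structures is rendered by its members with universe included in an arbitrary
  type \<open>'a\<close>; the order is a relation on these structures.\<close>

definition limit_ordinal :: "'o rel \<Rightarrow> bool" where
  "limit_ordinal \<delta> \<longleftrightarrow>
    Well_order \<delta> \<and> Field \<delta> \<noteq> {} \<and> (\<forall>i\<in>Field \<delta>. \<exists>j\<in>Field \<delta>. i \<noteq> j \<and> (i, j) \<in> \<delta>)"

type_synonym ('f, 'r, 'a) struct_class = "('f, 'r, 'a) struct set \<times> ('f, 'r, 'a) struct rel"

definition basic_axioms :: "('f, 'r) vocab \<Rightarrow> ('f, 'r, 'a) struct_class \<Rightarrow> bool" where
  "basic_axioms \<tau> = (\<lambda>(K, R).
    (\<forall>M\<in>K. is_struct M \<and> voc M = \<tau>) \<and>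
    partial_order_on K R \<and>
    (\<forall>M N. (M, N) \<in> R \<longrightarrow> substruct M N) \<and>
    (\<forall>M M' h. M \<in> K \<and> is_iso h M M' \<longrightarrow> M' \<in> K) \<and>
    (\<forall>M N M' N' h. (M, N) \<in> R \<and> is_iso h N N' \<and> is_iso h M M' \<longrightarrow> (M', N') \<in> R))"

definition coherence :: "('f, 'r, 'a) struct_class \<Rightarrow> bool" where
  "coherence = (\<lambda>(K, R).
    \<forall>M0\<in>K. \<forall>M1\<in>K. \<forall>M2\<in>K.
      substruct M0 M1 \<and> (M1, M2) \<in> R \<and> (M0, M2) \<in> R \<longrightarrow> (M0, M1) \<in> R)"

text \<open>The Tarski-Vaught axioms for chains of length \<open>\<delta>\<close>; in the second conjunct, \<open>i0\<close> is the
  least element of \<open>\<delta>\<close>.\<close>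

definition chain_axioms ::
  "('f, 'r) vocab \<Rightarrow> 'o rel \<Rightarrow> ('f, 'r, 'a) struct_class \<Rightarrow> bool" where
  "chain_axioms \<tau> \<delta> = (\<lambda>(K, R).
    \<forall>Ms. (\<forall>i j. (i, j) \<in> \<delta> \<longrightarrow> (Ms i, Ms j) \<in> R) \<longrightarrow>
      (let M = union_struct \<tau> (Field \<delta>) Ms in
        M \<in> K \<and>
        (\<forall>i0\<in>Field \<delta>. (\<forall>i\<in>Field \<delta>. (i0, i) \<in> \<delta>) \<longrightarrow> (Ms i0, M) \<in> R) \<and>
        (\<forall>N\<in>K. (\<forall>i\<in>Field \<delta>. (Ms i, N) \<in> R) \<longrightarrow> (M, N) \<in> R)))"

definition voc_card :: "('f, 'r) vocab \<Rightarrow> ('f + 'r) rel" where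
  "voc_card \<tau> = |dom (fun_ar \<tau>)| +c |dom (rel_ar \<tau>)|"

definition LST_axiom ::
  "('f, 'r) vocab \<Rightarrow> ('f, 'r, 'a) struct_class \<Rightarrow> 'l rel \<Rightarrow> bool" where
  "LST_axiom \<tau> = (\<lambda>(K, R) \<mu>.
    Card_order \<mu> \<and> voc_card \<tau> +c natLeq \<le>o \<mu> \<and>
    (\<forall>N\<in>K. \<forall>A. A \<subseteq> univ N \<longrightarrow>
      (\<exists>M\<in>K. A \<subseteq> univ M \<and> (M, N) \<in> R \<and> |univ M| \<le>o |A| +c \<mu>)))"

text \<open>A definition cannot quantify over types, so the types \<open>'o\<close> of the indices of chains
  and \<open>'l\<close> of the cardinal in the Loewenheim-Skolem-Tarski axiom are parameters.\<close>

definition AEC ::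
  "'o itself \<Rightarrow> 'l itself \<Rightarrow> ('f, 'r) vocab \<Rightarrow> ('f, 'r, 'a) struct_class \<Rightarrow> bool" where
  "AEC _ _ \<tau> \<K> \<longleftrightarrow>
    basic_axioms \<tau> \<K> \<and> coherence \<K> \<and>
    (\<forall>\<delta> :: 'o rel. limit_ordinal \<delta> \<longrightarrow> chain_axioms \<tau> \<delta> \<K>) \<and>
    (\<exists>\<mu> :: 'l rel. LST_axiom \<tau> \<K> \<mu>)"

text \<open>It is enough to compare \<open>\<mu>\<close> with cardinals on its own type, as every smaller cardinal
  is represented there.\<close>

definition is_LST_number ::
  "('f, 'r) vocab \<Rightarrow> ('f, 'r, 'a) struct_class \<Rightarrow> 'l rel \<Rightarrow> bool" where
  "is_LST_number \<tau> \<K> \<mu> \<longleftrightarrow>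
    LST_axiom \<tau> \<K> \<mu> \<and> (\<forall>\<mu>' :: 'l rel. LST_axiom \<tau> \<K> \<mu>' \<longrightarrow> \<mu> \<le>o \<mu>')"

definition cl ::
  "('f, 'r, 'a) struct_class \<Rightarrow> ('f, 'r, 'a) struct \<Rightarrow> 'a set \<Rightarrow> ('f, 'r, 'a) struct" where
  "cl = (\<lambda>(K, R) N A. restrict_struct N (\<Inter>{univ N0 | N0. (N0, N) \<in> R \<and> A \<subseteq> univ N0}))"

definition has_intersections :: "('f, 'r, 'a) struct_class \<Rightarrow> bool" where
  "has_intersections \<K> \<longleftrightarrow> (\<forall>N\<in>fst \<K>. \<forall>A. A \<subseteq> univ N \<longrightarrow> (cl \<K> N A, N) \<in> snd \<K>)"

section \<open>Structural logic\<close>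

datatype 'f tm = Var nat | App 'f "'f tm list"

fun tm_ok :: "('f, 'r) vocab \<Rightarrow> 'f tm \<Rightarrow> bool" where
  "tm_ok \<tau> (Var x) = True"
| "tm_ok \<tau> (App f ts) = (fun_ar \<tau> f = Some (length ts) \<and> (\<forall>t\<in>set ts. tm_ok \<tau> t))"

fun tm_vars :: "'f tm \<Rightarrow> nat set" where
  "tm_vars (Var x) = {x}"
| "tm_vars (App f ts) = (\<Union>t\<in>set ts. tm_vars t)"

fun tm_val :: "('f, 'r, 'a) struct \<Rightarrow> (nat \<Rightarrow> 'a) \<Rightarrow> 'f tm \<Rightarrow> 'a" where
  "tm_val N v (Var x) = v x"
| "tm_val N v (App f ts) = fn N f (map (tm_val N v) ts)"

text \<open>\<open>Conj \<Phi>\<close> and \<open>Disj \<Phi>\<close> stand for the conjunction and the disjunction of the set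
  \<open>ran \<Phi>\<close> of formulas. The index type \<open>'i\<close> is arbitrary, hence so is the size of that set.

  \<open>Qstruct M As x ys \<phi> \<psi>s\<close> binds \<open>x\<close> in \<open>\<phi>\<close> and \<open>ys ! i\<close> in \<open>\<psi>s ! i\<close> only. The elements of
  \<open>M\<close> are of the type \<open>'k\<close> that carries the cardinal \<open>\<kappa>\<close>.\<close>

datatype ('f, 'r, 'k, 'i) fm =
    Eq "'f tm" "'f tm"
  | Rel 'r "'f tm list"
  | Neg "('f, 'r, 'k, 'i) fm"
  | Conj "'i \<Rightarrow> ('f, 'r, 'k, 'i) fm option"
  | Disj "'i \<Rightarrow> ('f, 'r, 'k, 'i) fm option"
  | All nat "('f, 'r, 'k, 'i) fm"
  | Ex nat "('f, 'r, 'k, 'i) fm"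
  | Qstruct "('f, 'r, 'k) struct" "'k set list" nat "nat list"
      "('f, 'r, 'k, 'i) fm" "('f, 'r, 'k, 'i) fm list"

primrec fv :: "('f, 'r, 'k, 'i) fm \<Rightarrow> nat set" where
  "fv (Eq s t) = tm_vars s \<union> tm_vars t"
| "fv (Rel r ts) = (\<Union>t\<in>set ts. tm_vars t)"
| "fv (Neg \<phi>) = fv \<phi>"
| "fv (Conj \<Phi>) = \<Union>(ran (map_option fv \<circ> \<Phi>))"
| "fv (Disj \<Phi>) = \<Union>(ran (map_option fv \<circ> \<Phi>))"
| "fv (All x \<phi>) = fv \<phi> - {x}"
| "fv (Ex x \<phi>) = fv \<phi> - {x}"
| "fv (Qstruct M As x ys \<phi> \<psi>s) =
    (fv \<phi> - {x}) \<union> (\<Union>(y, V)\<in>set (zip ys (map fv \<psi>s)). V - {y})"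

primrec qfree :: "('f, 'r, 'k, 'i) fm \<Rightarrow> bool" where
  "qfree (Eq s t) = True"
| "qfree (Rel r ts) = True"
| "qfree (Neg \<phi>) = qfree \<phi>"
| "qfree (Conj \<Phi>) = (\<forall>b\<in>ran (map_option qfree \<circ> \<Phi>). b)"
| "qfree (Disj \<Phi>) = (\<forall>b\<in>ran (map_option qfree \<circ> \<Phi>). b)"
| "qfree (All x \<phi>) = False"
| "qfree (Ex x \<phi>) = False"
| "qfree (Qstruct M As x ys \<phi> \<psi>s) = False"

text \<open>An infinite cardinal \<open>\<kappa>\<close> is a cardinal order in the sense of the library. The ordinals below
  \<open>\<kappa>\<close> are its proper initial segments \<open>underS \<kappa> a\<close>, \<open>a \<in> Field \<kappa>\<close>.

  \<open>fm_ok \<kappa> \<tau> \<phi>\<close> means that \<open>\<phi>\<close> is a formula of structural logic in the vocabulary \<open>\<tau>\<close>.\<close>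

primrec fm_ok :: "'k rel \<Rightarrow> ('f, 'r) vocab \<Rightarrow> ('f, 'r, 'k, 'i) fm \<Rightarrow> bool" where
  "fm_ok \<kappa> \<tau> (Eq s t) = (tm_ok \<tau> s \<and> tm_ok \<tau> t)"
| "fm_ok \<kappa> \<tau> (Rel r ts) = (rel_ar \<tau> r = Some (length ts) \<and> (\<forall>t\<in>set ts. tm_ok \<tau> t))"
| "fm_ok \<kappa> \<tau> (Neg \<phi>) = fm_ok \<kappa> \<tau> \<phi>"
| "fm_ok \<kappa> \<tau> (Conj \<Phi>) =
    ((\<forall>b\<in>ran (map_option (fm_ok \<kappa> \<tau>) \<circ> \<Phi>). b) \<and> finite (fv (Conj \<Phi>)))"
| "fm_ok \<kappa> \<tau> (Disj \<Phi>) =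
    ((\<forall>b\<in>ran (map_option (fm_ok \<kappa> \<tau>) \<circ> \<Phi>). b) \<and> finite (fv (Disj \<Phi>)))"
| "fm_ok \<kappa> \<tau> (All x \<phi>) = fm_ok \<kappa> \<tau> \<phi>"
| "fm_ok \<kappa> \<tau> (Ex x \<phi>) = fm_ok \<kappa> \<tau> \<phi>"
| "fm_ok \<kappa> \<tau> (Qstruct M As x ys \<phi> \<psi>s) =
    (is_struct M \<and> sub_vocab (voc M) \<tau> \<and> (\<exists>a\<in>Field \<kappa>. univ M = underS \<kappa> a) \<and>
     length As = length \<psi>s \<and> length ys = length \<psi>s \<and> (\<forall>A\<in>set As. A \<subseteq> univ M) \<and>
     fm_ok \<kappa> \<tau> \<phi> \<and> (\<forall>b\<in>set (map (fm_ok \<kappa> \<tau>) \<psi>s). b))"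

text \<open>The set \<open>\<phi>(N, b)\<close> of solutions of \<open>\<phi>\<close> in the variable \<open>x\<close>, for a predicate \<open>P\<close> on structures
  and assignments (the semantics of \<open>\<phi>\<close>); the parameters \<open>b\<close> are given by the assignment \<open>v\<close>.\<close>

definition solutions ::
  "(('f, 'r, 'a) struct \<Rightarrow> (nat \<Rightarrow> 'a) \<Rightarrow> bool) \<Rightarrow> nat \<Rightarrow>
   ('f, 'r, 'a) struct \<Rightarrow> (nat \<Rightarrow> 'a) \<Rightarrow> 'a set" where
  "solutions P x N v = {a \<in> univ N. P N (v(x := a))}"

primrec sat ::
  "('f, 'r, 'k, 'i) fm \<Rightarrow> ('f, 'r, 'a) struct \<Rightarrow> (nat \<Rightarrow> 'a) \<Rightarrow> bool" where
  "sat (Eq s t) = (\<lambda>N v. tm_val N v s = tm_val N v t)"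
| "sat (Rel r ts) = (\<lambda>N v. rl N r (map (tm_val N v) ts))"
| "sat (Neg \<phi>) = (\<lambda>N v. \<not> sat \<phi> N v)"
| "sat (Conj \<Phi>) = (\<lambda>N v. \<forall>P\<in>ran (map_option sat \<circ> \<Phi>). P N v)"
| "sat (Disj \<Phi>) = (\<lambda>N v. \<exists>P\<in>ran (map_option sat \<circ> \<Phi>). P N v)"
| "sat (All x \<phi>) = (\<lambda>N v. \<forall>a\<in>univ N. sat \<phi> N (v(x := a)))"
| "sat (Ex x \<phi>) = (\<lambda>N v. \<exists>a\<in>univ N. sat \<phi> N (v(x := a)))"
| "sat (Qstruct M As x ys \<phi> \<psi>s) = (\<lambda>N v.
    (\<forall>i<length \<psi>s. solutions (map sat \<psi>s ! i) (ys ! i) N v \<subseteq> solutions (sat \<phi>) x N v) \<and>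
    (\<exists>N0 f. substruct N0 (reduct (voc M) N) \<and> univ N0 = solutions (sat \<phi>) x N v \<and>
      is_iso f N0 M \<and>
      (\<forall>i<length \<psi>s. f ` solutions (map sat \<psi>s ! i) (ys ! i) N v = As ! i)))"

abbreviation defset ::
  "('f, 'r, 'k, 'i) fm \<Rightarrow> nat \<Rightarrow> ('f, 'r, 'a) struct \<Rightarrow> (nat \<Rightarrow> 'a) \<Rightarrow> 'a set" where
  "defset \<phi> \<equiv> solutions (sat \<phi>)"

text \<open>The clauses of the above recursions that are stated through mapping, in readable form.\<close>

lemma fv_Conj_Disj:
  "fv (Conj \<Phi>) = (\<Union>\<phi>\<in>ran \<Phi>. fv \<phi>)" "fv (Disj \<Phi>) = (\<Union>\<phi>\<in>ran \<Phi>. fv \<phi>)"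
  by (auto simp: ran_def)

lemma fv_Qstruct:
  assumes "length ys = length \<psi>s"
  shows "fv (Qstruct M As x ys \<phi> \<psi>s) = (fv \<phi> - {x}) \<union> (\<Union>i<length \<psi>s. fv (\<psi>s ! i) - {ys ! i})"
proof -
  have "set (zip ys (map fv \<psi>s)) = (\<lambda>i. (ys ! i, fv (\<psi>s ! i))) ` {..<length \<psi>s}"
    using assms by (auto simp: set_zip image_def)
  then show ?thesis by simp
qed

lemma qfree_Conj_Disj:
  "qfree (Conj \<Phi>) \<longleftrightarrow> (\<forall>\<phi>\<in>ran \<Phi>. qfree \<phi>)" "qfree (Disj \<Phi>) \<longleftrightarrow> (\<forall>\<phi>\<in>ran \<Phi>. qfree \<phi>)"
  by (auto simp: ran_def)

lemma fm_ok_Conj_Disj: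
  "fm_ok \<kappa> \<tau> (Conj \<Phi>) \<longleftrightarrow> (\<forall>\<phi>\<in>ran \<Phi>. fm_ok \<kappa> \<tau> \<phi>) \<and> finite (\<Union>\<phi>\<in>ran \<Phi>. fv \<phi>)"
  "fm_ok \<kappa> \<tau> (Disj \<Phi>) \<longleftrightarrow> (\<forall>\<phi>\<in>ran \<Phi>. fm_ok \<kappa> \<tau> \<phi>) \<and> finite (\<Union>\<phi>\<in>ran \<Phi>. fv \<phi>)"
  unfolding fv_Conj_Disj[symmetric] by (auto simp: ran_def)

lemma sat_Conj_Disj:
  "sat (Conj \<Phi>) N v \<longleftrightarrow> (\<forall>\<phi>\<in>ran \<Phi>. sat \<phi> N v)"
  "sat (Disj \<Phi>) N v \<longleftrightarrow> (\<exists>\<phi>\<in>ran \<Phi>. sat \<phi> N v)"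
  by (auto simp: ran_def)

lemma sat_Qstruct:
  "sat (Qstruct M As x ys \<phi> \<psi>s) N v \<longleftrightarrow>
    (\<forall>i<length \<psi>s. defset (\<psi>s ! i) (ys ! i) N v \<subseteq> defset \<phi> x N v) \<and>
    (\<exists>N0 f. substruct N0 (reduct (voc M) N) \<and> univ N0 = defset \<phi> x N v \<and> is_iso f N0 M \<and>
      (\<forall>i<length \<psi>s. f ` defset (\<psi>s ! i) (ys ! i) N v = As ! i))"
  by (simp cong: conj_cong)

text \<open>The truth value of a sentence does not depend on the assignment.\<close>

definition Mod :: "('f, 'r) vocab \<Rightarrow> ('f, 'r, 'k, 'i) fm set \<Rightarrow> ('f, 'r, 'a) struct set" where
  "Mod \<tau> T = {N. is_struct N \<and> voc N = \<tau> \<and> (\<forall>\<sigma>\<in>T. \<forall>v. sat \<sigma> N v)}"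

text \<open>The disjunction over the non-empty set \<open>S\<close> is a \<open>Disj \<Phi>\<close> where \<open>ran \<Phi>\<close> is the set of
  disjuncts; the vocabulary of \<open>M\<close> may vary with \<open>(M, As) \<in> S\<close>.\<close>

definition forall_Q_sentence ::
  "'k rel \<Rightarrow> ('f, 'r) vocab \<Rightarrow> ('f, 'r, 'k, 'i) fm \<Rightarrow> bool" where
  "forall_Q_sentence \<kappa> \<tau> \<sigma> \<longleftrightarrow>
    fm_ok \<kappa> \<tau> \<sigma> \<and> fv \<sigma> = {} \<and>
    (\<exists>zs \<Phi> S x ys \<phi> \<psi>s.
      \<sigma> = foldr All zs (Disj \<Phi>) \<and>
      S \<noteq> {} \<and> ran \<Phi> = {Qstruct M As x ys \<phi> \<psi>s | M As. (M, As) \<in> S} \<and>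
      qfree \<phi> \<and> (\<forall>\<psi>\<in>set \<psi>s. qfree \<psi>))"

definition forall_Q_theory ::
  "'k rel \<Rightarrow> ('f, 'r) vocab \<Rightarrow> ('f, 'r, 'k, 'i) fm set \<Rightarrow> bool" where
  "forall_Q_theory \<kappa> \<tau> T \<longleftrightarrow> (\<forall>\<sigma>\<in>T. forall_Q_sentence \<kappa> \<tau> \<sigma>)"

section \<open>Fragments\<close>

fun immediate_subfms :: "('f, 'r, 'k, 'i) fm \<Rightarrow> ('f, 'r, 'k, 'i) fm set" where
  "immediate_subfms (Eq s t) = {}"
| "immediate_subfms (Rel r ts) = {}"
| "immediate_subfms (Neg \<phi>) = {\<phi>}"
| "immediate_subfms (Conj \<Phi>) = ran \<Phi>"
| "immediate_subfms (Disj \<Phi>) = ran \<Phi>"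
| "immediate_subfms (All x \<phi>) = {\<phi>}"
| "immediate_subfms (Ex x \<phi>) = {\<phi>}"
| "immediate_subfms (Qstruct M As x ys \<phi> \<psi>s) = insert \<phi> (set \<psi>s)"

definition atomic :: "('f, 'r, 'k, 'i) fm \<Rightarrow> bool" where
  "atomic \<phi> \<longleftrightarrow> (\<exists>s t. \<phi> = Eq s t) \<or> (\<exists>r ts. \<phi> = Rel r ts)"

definition fragment ::
  "'k rel \<Rightarrow> ('f, 'r) vocab \<Rightarrow> ('f, 'r, 'k, 'i) fm set \<Rightarrow> bool" where
  "fragment \<kappa> \<tau> F \<longleftrightarrow>
    (\<forall>\<phi>\<in>F. fm_ok \<kappa> \<tau> \<phi>) \<and>
    (\<forall>\<phi>\<in>F. immediate_subfms \<phi> \<subseteq> F) \<and>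
    (\<forall>\<phi>. atomic \<phi> \<and> fm_ok \<kappa> \<tau> \<phi> \<longrightarrow> \<phi> \<in> F)"

definition smallest_fragment ::
  "'k rel \<Rightarrow> ('f, 'r) vocab \<Rightarrow> ('f, 'r, 'k, 'i) fm set \<Rightarrow> ('f, 'r, 'k, 'i) fm set \<Rightarrow> bool" where
  "smallest_fragment \<kappa> \<tau> T F \<longleftrightarrow>
    fragment \<kappa> \<tau> F \<and> T \<subseteq> F \<and> (\<forall>F'. fragment \<kappa> \<tau> F' \<and> T \<subseteq> F' \<longrightarrow> F \<subseteq> F')"

text \<open>A tuple of parameters in \<open>N1\<close> for \<open>\<phi>\<close> is an assignment that maps the free variables of \<open>\<phi>\<close>
  into the universe of \<open>N1\<close> (its other values are irrelevant). This makes sense for sentences even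
  if the universe is empty.\<close>

definition elem_sub ::
  "('f, 'r, 'k, 'i) fm set \<Rightarrow> ('f, 'r, 'a) struct \<Rightarrow> ('f, 'r, 'a) struct \<Rightarrow> bool" where
  "elem_sub F N1 N2 \<longleftrightarrow>
    substruct N1 N2 \<and>
    (\<forall>\<phi>\<in>F. \<forall>v. v ` fv \<phi> \<subseteq> univ N1 \<longrightarrow> sat \<phi> N1 v = sat \<phi> N2 v)"

definition elem_sub_star ::
  "'k rel \<Rightarrow> ('f, 'r, 'k, 'i) fm set \<Rightarrow> ('f, 'r, 'a) struct \<Rightarrow> ('f, 'r, 'a) struct \<Rightarrow> bool" where
  "elem_sub_star \<kappa> F N1 N2 \<longleftrightarrow>
    elem_sub F N1 N2 \<and>
    (\<forall>M As x ys \<phi> \<psi>s v.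
      Qstruct M As x ys \<phi> \<psi>s \<in> F \<and> v ` fv (Qstruct M As x ys \<phi> \<psi>s) \<subseteq> univ N1 \<and>
      |defset \<phi> x N1 v| <o \<kappa> \<longrightarrow>
        defset \<phi> x N1 v = defset \<phi> x N2 v \<and>
        (\<forall>i<length \<psi>s. defset (\<psi>s ! i) (ys ! i) N1 v = defset (\<psi>s ! i) (ys ! i) N2 v))"

definition Mod_fragment ::
  "'k rel \<Rightarrow> ('f, 'r) vocab \<Rightarrow> ('f, 'r, 'k, 'i) fm set \<Rightarrow> ('f, 'r, 'k, 'i) fm set \<Rightarrow>
   ('f, 'r, 'a) struct_class" where
  "Mod_fragment \<kappa> \<tau> F T =
    (Mod \<tau> T, {(N1, N2). N1 \<in> Mod \<tau> T \<and> N2 \<in> Mod \<tau> T \<and> elem_sub_star \<kappa> F N1 N2})"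

text \<open>The cardinal \<open>\<kappa>\<^sup>-\<close>: the predecessor of \<open>\<kappa>\<close> if \<open>\<kappa>\<close> is a successor cardinal, and \<open>\<kappa>\<close> itself
  otherwise. The predecessor is unique up to order isomorphism.\<close>

definition card_pred :: "'k rel \<Rightarrow> 'k rel" where
  "card_pred \<kappa> =
    (if \<exists>\<kappa>0 :: 'k rel. Card_order \<kappa>0 \<and> \<kappa> =o cardSuc \<kappa>0
     then SOME \<kappa>0. Card_order \<kappa>0 \<and> \<kappa> =o cardSuc \<kappa>0
     else \<kappa>)"

end

theory Submission
  imports Defs
begin

text \<open>In a model \<open>N\<close> of \<open>T\<close>, each formula \<open>Q x ys \<phi> \<psi>s\<close> of the fragment defines, for each
  tuple of parameters, a set \<open>\<phi>(N, b)\<close> of size less than \<open>\<kappa>\<close> that contains all \<open>\<psi>\<^sub>i(N, b)\<close>.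
  As \<open>\<phi>\<close> and the \<open>\<psi>\<^sub>i\<close> are quantifier-free, the models \<open>N1\<close> with \<open>N1 \<preceq>\<^sup>* N\<close> are exactly the
  substructures whose universe contains \<open>\<phi>(N, b)\<close> for all its tuples \<open>b\<close>. So the order amounts to
  closedness under finitary set-valued operations: closed sets are stable under intersections and
  unions of chains, and the closure of \<open>A\<close> is obtained by iterating \<open>|F|\<close> many operations whose
  values have size at most \<open>\<kappa>\<^sup>-\<close>.\<close>

section \<open>Cardinal arithmetic\<close>

text \<open>The size proviso in the order costs nothing: a sentence of \<open>T\<close> puts
  \<phi>(N, b) in bijection with the universe of some \<open>M\<close>, an ordinal below \<kappa>,
  so it holds in every model. The obstacle is truth of the formulas of \<open>F\<close> that are not
  quantifier-free. A formula \<open>Qstruct\<close> asks for an embedding of \<open>M\<close> with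
  prescribed images; such embeddings can be composed with a map from N1 to N2, and factored back
  through it once the prescribed sets lie in its image. Universal formulas do not pass upwards in
  general, but minimality of \<open>F\<close> leaves only tails of the quantifier prefixes of
  sentences of \<open>T\<close>, and in a non-empty model these hold at all parameters.
  Substructures, isomorphic copies and unions of chains are thus served by one transfer principle
  for embeddings with closed image. The empty universe needs care: a non-empty prefix makes a
  sentence vacuous there, while the disjunction under it may fail. The constant
  \<open>\<kappa>\<^sup>-\<close> is the least infinite cardinal that bounds all cardinals below
  \<kappa>.\<close>

lemma finite_ordLess_Cinfinite: "finite A \<Longrightarrow> Cinfinite r \<Longrightarrow> |A| <o r"
  by (rule Cfinite_ordLess_Cinfinite) (auto simp: cfinite_def Field_card_of card_of_card_order_on)

text \<open>Products do not exceed an infinite cardinal, which handles each fixed length by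
  induction; the lengths contribute only a countable union.\<close>

lemma card_of_lists_ordLeq:
  assumes r: "Cinfinite r" and X: "|X| \<le>o r"
  shows "|lists X| \<le>o r"
proof -
  have inf: "\<not> finite (Field r)" and co: "Card_order r" using r by (auto simp: cinfinite_def)
  have "|{xs \<in> lists X. length xs = n}| \<le>o r" for n
  proof (induction n)
    case 0
    have "finite {xs \<in> lists X. length xs = 0}" by (rule finite_subset[of _ "{[]}"]) auto
    then show ?case using finite_ordLess_Cinfinite[OF _ r] ordLess_imp_ordLeq by blast
  next
    case (Suc n)
    let ?L = "{xs \<in> lists X. length xs = n}"
    have "{xs \<in> lists X. length xs = Suc n} \<subseteq> (\<lambda>(a, xs). a # xs) ` (X \<times> ?L)"
      by (auto simp: length_Suc_conv image_iff)
    from ordLeq_transitive[OF card_of_mono1[OF this] card_of_image]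
    show ?case
      using card_of_Times_ordLeq_infinite_Field[OF inf X Suc.IH co] by (rule ordLeq_transitive)
  qed
  moreover have "|UNIV :: nat set| \<le>o r"
    using natLeq_ordLeq_cinfinite[OF r] card_of_nat ordIso_ordLeq_trans by blast
  ultimately have "|\<Union>n. {xs \<in> lists X. length xs = n}| \<le>o r"
    by (intro card_of_UNION_ordLeq_infinite_Field[OF inf co]) auto
  moreover have "(\<Union>n. {xs \<in> lists X. length xs = n}) = lists X" by auto
  ultimately show ?thesis by simp
qed

text \<open>A Skolem hull for set-valued operations. Since arguments are finite lists, \<omega>
  stages suffice, and each stage adds at most \<open>r\<close> many sets of size at most
  \<open>r\<close>.\<close>

lemma closure_ordLeq:
  fixes g :: "'i \<Rightarrow> 'a list \<Rightarrow> 'a set"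
  assumes r: "Cinfinite r" and A: "|A| \<le>o r" and I: "|I| \<le>o r"
    and g: "\<And>i xs. i \<in> I \<Longrightarrow> |g i xs| \<le>o r"
  obtains B where "A \<subseteq> B" "|B| \<le>o r" "\<And>i xs. i \<in> I \<Longrightarrow> set xs \<subseteq> B \<Longrightarrow> g i xs \<subseteq> B"
proof -
  have inf: "\<not> finite (Field r)" and co: "Card_order r" using r by (auto simp: cinfinite_def)
  define step where "step X = X \<union> (\<Union>(i, xs) \<in> I \<times> lists X. g i xs)" for X
  define B where "B n = (step ^^ n) A" for n
  have B_Suc: "B (Suc n) = step (B n)" for n by (simp add: B_def)
  have "mono B" by (rule mono_iff_le_Suc[THEN iffD2]) (auto simp: B_Suc step_def)
  have "|step X| \<le>o r" if X: "|X| \<le>o r" for X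
  proof -
    have "|\<Union>(i, xs) \<in> I \<times> lists X. g i xs| \<le>o r"
      using card_of_Times_ordLeq_infinite_Field[OF inf I card_of_lists_ordLeq[OF r X] co] g
      by (intro card_of_UNION_ordLeq_infinite_Field[OF inf co]) auto
    then show ?thesis unfolding step_def by (rule card_of_Un_ordLeq_infinite_Field[OF inf X _ co])
  qed
  then have card_B: "|B n| \<le>o r" for n
    by (induction n) (simp_all add: B_Suc A, simp add: B_def A)
  show thesis
  proof (rule that)
    show "A \<subseteq> (\<Union>n. B n)" using UN_upper[of 0 UNIV B] by (simp add: B_def)
    have "|UNIV :: nat set| \<le>o r"
      using natLeq_ordLeq_cinfinite[OF r] card_of_nat ordIso_ordLeq_trans by blast
    then show "|\<Union>n. B n| \<le>o r"
      using card_B by (intro card_of_UNION_ordLeq_infinite_Field[OF inf co]) auto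
  next
    fix i xs assume i: "i \<in> I" and xs: "set xs \<subseteq> (\<Union>n. B n)"
    \<comment> \<open>The stages increase, so the finitely many entries already occur together at
      one stage, and the next stage contains the value.\<close>
    have "\<exists>n. set xs \<subseteq> B n" using xs
    proof (induction xs)
      case (Cons x xs)
      then obtain n m where "set xs \<subseteq> B n" "x \<in> B m" by auto
      then have "set (x # xs) \<subseteq> B (max n m)"
        using monoD[OF \<open>mono B\<close>, of n "max n m"] monoD[OF \<open>mono B\<close>, of m "max n m"] by auto
      then show ?case ..
    qed simp
    then obtain n where "set xs \<subseteq> B n" ..
    then have "g i xs \<subseteq> B (Suc n)" using i by (auto simp: B_Suc step_def)
    then show "g i xs \<subseteq> (\<Union>n. B n)" by blast
  qed
qed

text \<open>A set smaller than a successor cardinal has at most the size of the predecessor; when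
  \<kappa> is no successor, \<kappa> itself serves as the bound.\<close>

lemma card_pred_Cinfinite:
  assumes \<kappa>: "Cinfinite \<kappa>"
  shows "Cinfinite (card_pred \<kappa>)" and "|X| <o \<kappa> \<Longrightarrow> |X| \<le>o card_pred \<kappa>"
proof -
  have "Cinfinite (card_pred \<kappa>) \<and> ( |X| <o \<kappa> \<longrightarrow> |X| \<le>o card_pred \<kappa>)"
  proof (cases "\<exists>\<kappa>0 :: 'a rel. Card_order \<kappa>0 \<and> \<kappa> =o cardSuc \<kappa>0")
    case True
    then have *: "Card_order (card_pred \<kappa>)" "\<kappa> =o cardSuc (card_pred \<kappa>)"
      unfolding card_pred_def using someI_ex[OF True] by auto
    then have "Cinfinite (cardSuc (card_pred \<kappa>))" using \<kappa> Cinfinite_cong by blast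
    \<comment> \<open>A finite cardinal has a finite successor, so the predecessor of the infinite
      \<kappa> is infinite.\<close>
    then have "Cinfinite (card_pred \<kappa>)" using *(1) by (simp add: cinfinite_def cardSuc_finite)
    moreover have "|X| \<le>o card_pred \<kappa>" if "|X| <o \<kappa>"
      using ordLess_ordIso_trans[OF that *(2)] cardSuc_ordLeq_ordLess[OF *(1) card_of_Card_order]
      by blast
    ultimately show ?thesis by blast
  next
    case False
    then have "card_pred \<kappa> = \<kappa>" unfolding card_pred_def by (rule if_not_P)
    then show ?thesis using \<kappa> ordLess_imp_ordLeq by metis
  qed
  then show "Cinfinite (card_pred \<kappa>)" and "|X| <o \<kappa> \<Longrightarrow> |X| \<le>o card_pred \<kappa>" by blast+
qed

section \<open>Semantics\<close>

lemma tm_val_cong: "\<forall>x\<in>tm_vars t. v x = w x \<Longrightarrow> tm_val N v t = tm_val N w t"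
proof (induction t)
  case (App f ts)
  then have "map (tm_val N v) ts = map (tm_val N w) ts" by auto
  then show ?case by (metis tm_val.simps(2))
qed simp

lemma solutions_cong:
  assumes "\<And>v w. \<forall>z\<in>V. v z = w z \<Longrightarrow> P N v = P N w"
    and "\<forall>z\<in>V - {x}. v z = w z"
  shows "solutions P x N v = solutions P x N w"
proof -
  have "P N (v(x := a)) = P N (w(x := a))" for a
    using assms(2) by (intro assms(1)) auto
  then show ?thesis by (simp add: solutions_def)
qed

text \<open>In the induction rule of \<open>fm\<close>, the hypotheses for \<open>Conj\<close> and
  \<open>Disj\<close> concern option values in \<open>range \<Phi>\<close>; this connects them with
  the readable clauses, which speak of \<open>ran \<Phi>\<close>.\<close>

lemma ran_rangeI: "y \<in> ran m \<Longrightarrow> Some y \<in> range m"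
  by (auto simp: ran_def intro: range_eqI[OF sym])

text \<open>\<open>fm_ok\<close> enters through \<open>Qstruct\<close>: \<open>fv\<close> pairs
  bound variables with bodies by \<open>zip\<close>, which would drop bodies if the lists differed
  in length.\<close>

lemma sat_cong:
  assumes "fm_ok \<kappa> \<tau> \<phi>" and "\<forall>x\<in>fv \<phi>. v x = w x"
  shows "sat \<phi> N v = sat \<phi> N w"
  using assms
proof (induction \<phi> arbitrary: v w)
  case (Eq s t)
  then have "tm_val N v s = tm_val N w s" "tm_val N v t = tm_val N w t"
    by (auto intro!: tm_val_cong)
  then show ?case by simp
next
  case (Rel r ts)
  then have "map (tm_val N v) ts = map (tm_val N w) ts"
    by (auto intro!: tm_val_cong)
  then show ?case by (metis sat.simps(2))
next
  case (Neg \<phi>)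
  then show ?case by (metis fm_ok.simps(3) fv.simps(3) sat.simps(3))
next
  case (Conj \<Phi>)
  have "sat \<phi> N v = sat \<phi> N w" if "\<phi> \<in> ran \<Phi>" for \<phi>
  proof -
    from that have "Some \<phi> \<in> range \<Phi>" by (rule ran_rangeI)
    then show ?thesis
      using Conj.prems that
      by (intro Conj.IH[of "Some \<phi>"]) (auto simp: fm_ok_Conj_Disj fv_Conj_Disj simp del: fv.simps fm_ok.simps)
  qed
  then show ?case unfolding sat_Conj_Disj by blast
next
  case (Disj \<Phi>)
  have "sat \<phi> N v = sat \<phi> N w" if "\<phi> \<in> ran \<Phi>" for \<phi>
  proof -
    from that have "Some \<phi> \<in> range \<Phi>" by (rule ran_rangeI)
    then show ?thesis
      using Disj.prems that
      by (intro Disj.IH[of "Some \<phi>"]) (auto simp: fm_ok_Conj_Disj fv_Conj_Disj simp del: fv.simps fm_ok.simps)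
  qed
  then show ?case unfolding sat_Conj_Disj by blast
next
  case (All x \<phi>)
  then have "sat \<phi> N (v(x := a)) = sat \<phi> N (w(x := a))" for a
    by (intro All.IH) auto
  then show ?case by simp
next
  case (Ex x \<phi>)
  then have "sat \<phi> N (v(x := a)) = sat \<phi> N (w(x := a))" for a
    by (intro Ex.IH) auto
  then show ?case by simp
next
  case (Qstruct M As x ys \<phi> \<psi>s)
  then have len: "length ys = length \<psi>s" by simp
  note fv = fv_Qstruct[OF len]
  have "defset \<phi> x N v = defset \<phi> x N w"
    using Qstruct.prems unfolding fv
    by (intro solutions_cong[where V = "fv \<phi>"] Qstruct.IH(1)) auto
  moreover have "defset (\<psi>s ! i) (ys ! i) N v = defset (\<psi>s ! i) (ys ! i) N w" if "i < length \<psi>s" for i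
    using Qstruct.prems that unfolding fv
    by (intro solutions_cong[where V = "fv (\<psi>s ! i)"] Qstruct.IH(2)[of "\<psi>s ! i"]) auto
  ultimately show ?case unfolding sat_Qstruct by simp
qed

lemma defset_cong:
  assumes "fm_ok \<kappa> \<tau> \<phi>" and "\<forall>z\<in>fv \<phi> - {x}. v z = w z"
  shows "defset \<phi> x N v = defset \<phi> x N w"
  using sat_cong[OF assms(1)] assms(2) by (intro solutions_cong[where V = "fv \<phi>"]) auto

lemma finite_tm_vars: "finite (tm_vars t)"
  by (induction t) auto

lemma finite_fv: "fm_ok \<kappa> \<tau> \<phi> \<Longrightarrow> finite (fv \<phi>)"
proof (induction \<phi>)
  case (Qstruct M As x ys \<phi> \<psi>s)
  then have "length ys = length \<psi>s" by simp
  with Qstruct show ?case by (subst fv_Qstruct) auto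
qed (auto simp: finite_tm_vars)

text \<open>The prefix acts as a single quantifier over assignments. Repeated variables are
  harmless, because only the innermost value survives; over an empty universe a non-empty prefix
  admits no \<open>w\<close> at all.\<close>

lemma sat_foldr_All:
  "sat (foldr All zs \<phi>) N v \<longleftrightarrow>
    (\<forall>w. w ` set zs \<subseteq> univ N \<and> (\<forall>z. z \<notin> set zs \<longrightarrow> w z = v z) \<longrightarrow> sat \<phi> N w)"
proof (induction zs arbitrary: v)
  case Nil
  have "w = v" if "\<forall>z. w z = v z" for w using that by auto
  then show ?case by auto
next
  case (Cons z zs)
  show ?case
  proof
    assume *: "sat (foldr All (z # zs) \<phi>) N v"
    show "\<forall>w. w ` set (z # zs) \<subseteq> univ N \<and> (\<forall>u. u \<notin> set (z # zs) \<longrightarrow> w u = v u) \<longrightarrow> sat \<phi> N w"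
    proof (intro allI impI)
      fix w assume w: "w ` set (z # zs) \<subseteq> univ N \<and> (\<forall>u. u \<notin> set (z # zs) \<longrightarrow> w u = v u)"
      with * have "sat (foldr All zs \<phi>) N (v(z := w z))" by simp
      with w show "sat \<phi> N w" unfolding Cons.IH by auto
    qed
  next
    assume *: "\<forall>w. w ` set (z # zs) \<subseteq> univ N \<and> (\<forall>u. u \<notin> set (z # zs) \<longrightarrow> w u = v u) \<longrightarrow> sat \<phi> N w"
    have "sat (foldr All zs \<phi>) N (v(z := a))" if "a \<in> univ N" for a
      unfolding Cons.IH
    proof (intro allI impI)
      fix w assume w: "w ` set zs \<subseteq> univ N \<and> (\<forall>u. u \<notin> set zs \<longrightarrow> w u = (v(z := a)) u)"
      \<comment> \<open>If \<open>z\<close> is quantified again further inside, its value comes from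
        there; otherwise it is \<open>a\<close>.\<close>
      then have "w z \<in> univ N" using that by (cases "z \<in> set zs") auto
      with w show "sat \<phi> N w" by (intro *[rule_format]) auto
    qed
    then show "sat (foldr All (z # zs) \<phi>) N v" by simp
  qed
qed

lemma fv_foldr_All: "fv (foldr All zs \<phi>) = fv \<phi> - set zs"
  by (induction zs) auto

section \<open>Embeddings\<close>

text \<open>The vocabulary of \<open>M\<close> may be a proper sub-vocabulary of the one of \<open>N\<close>; this way the
  structures in structural quantifiers and the substructures are treated alike.\<close>

definition embedding :: "('a \<Rightarrow> 'b) \<Rightarrow> ('f, 'r, 'a) struct \<Rightarrow> ('f, 'r, 'b) struct \<Rightarrow> bool" where
  "embedding h M N \<longleftrightarrow>
    inj_on h (univ M) \<and> h ` univ M \<subseteq> univ N \<and>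
    (\<forall>f xs. fun_ar (voc M) f = Some (length xs) \<and> set xs \<subseteq> univ M \<longrightarrow>
      h (fn M f xs) = fn N f (map h xs)) \<and>
    (\<forall>r xs. rel_ar (voc M) r = Some (length xs) \<and> set xs \<subseteq> univ M \<longrightarrow>
      rl M r xs = rl N r (map h xs))"

lemma is_iso_embedding: "is_iso h M N \<Longrightarrow> embedding h M N"
  by (auto simp: is_iso_def embedding_def bij_betw_def)

lemma substruct_embedding: "substruct M N \<Longrightarrow> embedding id M N"
  by (auto simp: substruct_def embedding_def)

lemma fn_closed:
  "is_struct M \<Longrightarrow> fun_ar (voc M) f = Some (length xs) \<Longrightarrow> set xs \<subseteq> univ M \<Longrightarrow> fn M f xs \<in> univ M"
  by (auto simp: is_struct_def)

lemma embedding_comp: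
  assumes g: "embedding g M N1" and h: "embedding h N1 N2" and sub: "sub_vocab (voc M) (voc N1)"
  shows "embedding (h \<circ> g) M N2"
proof -
  have sub: "fun_ar (voc N1) f = Some n" if "fun_ar (voc M) f = Some n" for f n
    using sub that by (auto simp: sub_vocab_def map_le_def dom_def)
  have sub': "rel_ar (voc N1) f = Some n" if "rel_ar (voc M) f = Some n" for f n
    using \<open>sub_vocab (voc M) (voc N1)\<close> that by (auto simp: sub_vocab_def map_le_def dom_def)
  have map_sub: "set (map g xs) \<subseteq> univ N1" if "set xs \<subseteq> univ M" for xs
    using that g by (auto simp: embedding_def)
  show ?thesis
    unfolding embedding_def
  proof (intro conjI allI impI; (elim conjE)?)
    show "inj_on (h \<circ> g) (univ M)"
      using g h by (auto simp: embedding_def intro!: comp_inj_on intro: inj_on_subset)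
    show "(h \<circ> g) ` univ M \<subseteq> univ N2" using g h by (auto simp: embedding_def)
  next
    fix f xs assume *: "fun_ar (voc M) f = Some (length xs)" "set xs \<subseteq> univ M"
    then have "fun_ar (voc N1) f = Some (length (map g xs))" by (simp add: sub)
    then have "h (fn N1 f (map g xs)) = fn N2 f (map h (map g xs))"
      using h map_sub[OF *(2)] unfolding embedding_def by blast
    then show "(h \<circ> g) (fn M f xs) = fn N2 f (map (h \<circ> g) xs)"
      using g * by (simp add: embedding_def)
  next
    fix r xs assume *: "rel_ar (voc M) r = Some (length xs)" "set xs \<subseteq> univ M"
    then have "rel_ar (voc N1) r = Some (length (map g xs))" by (simp add: sub')
    then have "rl N1 r (map g xs) = rl N2 r (map h (map g xs))"
      using h map_sub[OF *(2)] unfolding embedding_def by blast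
    then show "rl M r xs = rl N2 r (map (h \<circ> g) xs)"
      using g * by (simp add: embedding_def)
  qed
qed

text \<open>Both sides of each required equation are compared after applying the injective
  \<open>h\<close>, where they agree because \<open>g\<close> and \<open>h\<close> are embeddings.
  This pulls a copy of \<open>M\<close> found in the larger structure back to the smaller
  one.\<close>

lemma embedding_factor:
  assumes M: "is_struct M" and N1: "is_struct N1" and g: "embedding g M N2" and h: "embedding h N1 N2"
    and sub: "sub_vocab (voc M) (voc N1)" and im: "g ` univ M \<subseteq> h ` univ N1"
  shows "embedding (inv_into (univ N1) h \<circ> g) M N1"
proof -
  let ?k = "inv_into (univ N1) h \<circ> g"
  have subf: "fun_ar (voc N1) f = Some n" if "fun_ar (voc M) f = Some n" for f n
    using sub that by (auto simp: sub_vocab_def map_le_def dom_def)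
  have subr: "rel_ar (voc N1) f = Some n" if "rel_ar (voc M) f = Some n" for f n
    using sub that by (auto simp: sub_vocab_def map_le_def dom_def)
  have k: "?k a \<in> univ N1" "h (?k a) = g a" if "a \<in> univ M" for a
    using that im by (auto intro!: inv_into_into f_inv_into_f)
  have map_k: "set (map ?k xs) \<subseteq> univ N1" "map h (map ?k xs) = map g xs" if "set xs \<subseteq> univ M" for xs
    using that k by auto
  have inj_h: "inj_on h (univ N1)" using h by (simp add: embedding_def)
  show ?thesis
    unfolding embedding_def
  proof (intro conjI allI impI; (elim conjE)?)
    have "inj_on g (univ M)" using g by (simp add: embedding_def)
    then show "inj_on ?k (univ M)" using k(2) unfolding inj_on_def by metis
    show "?k ` univ M \<subseteq> univ N1" using k(1) by blast
  next
    fix f xs assume *: "fun_ar (voc M) f = Some (length xs)" "set xs \<subseteq> univ M"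
    then have ar: "fun_ar (voc N1) f = Some (length (map ?k xs))" by (simp add: subf)
    have "h (fn N1 f (map ?k xs)) = fn N2 f (map g xs)"
      using h ar map_k[OF *(2)] unfolding embedding_def by metis
    also have "\<dots> = h (?k (fn M f xs))"
      using g * k(2)[OF fn_closed[OF M *]] unfolding embedding_def by metis
    finally show "?k (fn M f xs) = fn N1 f (map ?k xs)"
      using inj_onD[OF inj_h] k(1)[OF fn_closed[OF M *]] fn_closed[OF N1 ar map_k(1)[OF *(2)]] by metis
  next
    fix r xs assume *: "rel_ar (voc M) r = Some (length xs)" "set xs \<subseteq> univ M"
    then have ar: "rel_ar (voc N1) r = Some (length (map ?k xs))" by (simp add: subr)
    then have "rl N1 r (map ?k xs) = rl N2 r (map g xs)"
      using h map_k[OF *(2)] unfolding embedding_def by metis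
    then show "rl M r xs = rl N1 r (map ?k xs)"
      using g * unfolding embedding_def by metis
  qed
qed

lemma embedding_tm_val:
  assumes h: "embedding h N1 N2" and N1: "is_struct N1"
    and "tm_ok (voc N1) t" and "v ` tm_vars t \<subseteq> univ N1"
  shows "tm_val N1 v t \<in> univ N1 \<and> tm_val N2 (h \<circ> v) t = h (tm_val N1 v t)"
  using assms(3,4)
proof (induction t)
  case (App f ts)
  have IH: "tm_val N1 v t \<in> univ N1 \<and> tm_val N2 (h \<circ> v) t = h (tm_val N1 v t)" if "t \<in> set ts" for t
    using App that by (intro App.IH) auto
  then have eq: "map (tm_val N2 (h \<circ> v)) ts = map h (map (tm_val N1 v) ts)"
    and sub: "set (map (tm_val N1 v) ts) \<subseteq> univ N1" by auto
  have ar: "fun_ar (voc N1) f = Some (length (map (tm_val N1 v) ts))" using App.prems by simp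
  show ?case
    using fn_closed[OF N1 ar sub] h ar sub eq unfolding embedding_def by (metis tm_val.simps(2))
qed auto

text \<open>Embeddings preserve and reflect atomic formulas, and negations and infinitary
  conjunctions and disjunctions inherit this. It is the reason for demanding quantifier-free \<phi>
  and \<psi>s in the sentences.\<close>

lemma embedding_sat:
  assumes h: "embedding h N1 N2" and N1: "is_struct N1"
    and "qfree \<phi>" and "fm_ok \<kappa> (voc N1) \<phi>" and "v ` fv \<phi> \<subseteq> univ N1"
  shows "sat \<phi> N2 (h \<circ> v) = sat \<phi> N1 v"
  using assms(3-5)
proof (induction \<phi>)
  case (Eq s t)
  have st: "tm_val N1 v s \<in> univ N1 \<and> tm_val N2 (h \<circ> v) s = h (tm_val N1 v s)"
      "tm_val N1 v t \<in> univ N1 \<and> tm_val N2 (h \<circ> v) t = h (tm_val N1 v t)"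
    using Eq by (auto intro!: embedding_tm_val[OF h N1] simp del: comp_apply)
  moreover have "inj_on h (univ N1)" using h by (simp add: embedding_def)
  ultimately show ?case by (metis sat.simps(1) inj_on_eq_iff)
next
  case (Rel r ts)
  have IH: "tm_val N1 v t \<in> univ N1 \<and> tm_val N2 (h \<circ> v) t = h (tm_val N1 v t)" if "t \<in> set ts" for t
    using Rel that by (intro embedding_tm_val[OF h N1]) auto
  then have eq: "map (tm_val N2 (h \<circ> v)) ts = map h (map (tm_val N1 v) ts)"
    and sub: "set (map (tm_val N1 v) ts) \<subseteq> univ N1" by auto
  have ar: "rel_ar (voc N1) r = Some (length (map (tm_val N1 v) ts))" using Rel.prems by simp
  show ?case
    using h ar sub eq unfolding embedding_def by (metis sat.simps(2))
next
  case (Conj \<Phi>)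
  have "sat \<phi> N2 (h \<circ> v) = sat \<phi> N1 v" if "\<phi> \<in> ran \<Phi>" for \<phi>
  proof -
    from that have "Some \<phi> \<in> range \<Phi>" by (rule ran_rangeI)
    then show ?thesis
      using Conj.prems that
      by (intro Conj.IH[of "Some \<phi>"])
        (auto simp: fm_ok_Conj_Disj fv_Conj_Disj qfree_Conj_Disj image_UN simp del: fv.simps fm_ok.simps qfree.simps)
  qed
  then show ?case unfolding sat_Conj_Disj by blast
next
  case (Disj \<Phi>)
  have "sat \<phi> N2 (h \<circ> v) = sat \<phi> N1 v" if "\<phi> \<in> ran \<Phi>" for \<phi>
  proof -
    from that have "Some \<phi> \<in> range \<Phi>" by (rule ran_rangeI)
    then show ?thesis
      using Disj.prems that
      by (intro Disj.IH[of "Some \<phi>"])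
        (auto simp: fm_ok_Conj_Disj fv_Conj_Disj qfree_Conj_Disj image_UN simp del: fv.simps fm_ok.simps qfree.simps)
  qed
  then show ?case unfolding sat_Conj_Disj by blast
qed auto

text \<open>The intersection is unavoidable: N2 may have further solutions outside the image. Closed
  sets are designed to exclude these.\<close>

lemma embedding_defset:
  assumes h: "embedding h N1 N2" and N1: "is_struct N1"
    and \<phi>: "qfree \<phi>" "fm_ok \<kappa> (voc N1) \<phi>" and v: "v ` (fv \<phi> - {x}) \<subseteq> univ N1"
  shows "h ` defset \<phi> x N1 v = defset \<phi> x N2 (h \<circ> v) \<inter> h ` univ N1"
proof -
  have "sat \<phi> N2 ((h \<circ> v)(x := h a)) = sat \<phi> N1 (v(x := a))" if "a \<in> univ N1" for a
  proof -
    have "(h \<circ> v)(x := h a) = h \<circ> (v(x := a))" by auto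
    moreover have "sat \<phi> N2 (h \<circ> (v(x := a))) = sat \<phi> N1 (v(x := a))"
      using v that by (intro embedding_sat[OF h N1 \<phi>]) auto
    ultimately show ?thesis by metis
  qed
  moreover have "h ` univ N1 \<subseteq> univ N2" using h by (simp add: embedding_def)
  ultimately show ?thesis by (auto simp: solutions_def)
qed

text \<open>\<open>g\<close> is the inverse of the isomorphism in the semantics of the quantifier.\<close>

lemma sat_Qstruct_embedding:
  assumes ok: "fm_ok \<kappa> (voc N) (Qstruct M As x ys \<phi> \<psi>s)" and N: "is_struct N"
  shows "sat (Qstruct M As x ys \<phi> \<psi>s) N v \<longleftrightarrow>
    (\<exists>g. embedding g M N \<and> g ` univ M = defset \<phi> x N v \<and>
      (\<forall>i<length \<psi>s. g ` (As ! i) = defset (\<psi>s ! i) (ys ! i) N v))"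
proof
  let ?B = "defset \<phi> x N v"
  assume "sat (Qstruct M As x ys \<phi> \<psi>s) N v"
  then obtain N0 f where sub: "\<forall>i<length \<psi>s. defset (\<psi>s ! i) (ys ! i) N v \<subseteq> ?B"
    and N0: "substruct N0 (reduct (voc M) N)" "univ N0 = ?B" and f: "is_iso f N0 M"
    and im: "\<forall>i<length \<psi>s. f ` defset (\<psi>s ! i) (ys ! i) N v = As ! i"
    unfolding sat_Qstruct by blast
  define g where "g = inv_into ?B f"
  have bij: "bij_betw f ?B (univ M)" using f N0 by (simp add: is_iso_def)
  have gf: "g (f a) = a" if "a \<in> ?B" for a
    using bij that by (simp add: g_def bij_betw_inv_into_left)
  have fg: "f (g a) = a" "g a \<in> ?B" if "a \<in> univ M" for a
    using bij that bij_betw_inv_into[OF bij]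
    by (auto simp: g_def bij_betw_inv_into_right bij_betw_def inv_into_into)
  have voc: "voc N0 = voc M" using f by (simp add: is_iso_def)
  have "embedding g M N"
    unfolding embedding_def
  proof (intro conjI allI impI; (elim conjE)?)
    show "inj_on g (univ M)" using fg(1) by (metis inj_onI)
    show "g ` univ M \<subseteq> univ N" using fg(2) by (auto simp: solutions_def)
  next
    fix c xs assume *: "fun_ar (voc M) c = Some (length xs)" "set xs \<subseteq> univ M"
    have ar: "fun_ar (voc N0) c = Some (length (map g xs))" using * voc by simp
    have s: "set (map g xs) \<subseteq> univ N0" using * fg N0(2) by auto
    have "map f (map g xs) = xs" using * fg by (simp add: map_idI subset_iff)
    then have "f (fn N0 c (map g xs)) = fn M c xs"
      using f ar s unfolding is_iso_def by metis
    then have "g (fn M c xs) = fn N0 c (map g xs)"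
      using gf fn_closed[OF _ ar s] f N0(2) unfolding is_iso_def by metis
    also have "\<dots> = fn (reduct (voc M) N) c (map g xs)"
      using N0(1) ar s unfolding substruct_def by metis
    also have "\<dots> = fn N c (map g xs)" using * by (simp add: reduct_def dom_def)
    finally show "g (fn M c xs) = fn N c (map g xs)" .
  next
    fix c xs assume *: "rel_ar (voc M) c = Some (length xs)" "set xs \<subseteq> univ M"
    have ar: "rel_ar (voc N0) c = Some (length (map g xs))" using * voc by simp
    have s: "set (map g xs) \<subseteq> univ N0" using * fg N0(2) by auto
    have "map f (map g xs) = xs" using * fg by (simp add: map_idI subset_iff)
    then have "rl M c xs = rl N0 c (map g xs)"
      using f ar s unfolding is_iso_def by metis
    also have "\<dots> = rl (reduct (voc M) N) c (map g xs)"
      using N0(1) ar s unfolding substruct_def by metis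
    also have "\<dots> = rl N c (map g xs)" using * by (simp add: reduct_def dom_def)
    finally show "rl M c xs = rl N c (map g xs)" .
  qed
  moreover have "g ` univ M = ?B"
    using bij_betw_inv_into[OF bij] by (simp add: g_def bij_betw_def)
  \<comment> \<open>Clause (i) of the semantics puts the set defined by \<psi>s ! i inside
    \<open>?B\<close>, where \<open>g\<close> inverts \<open>f\<close>.\<close>
  moreover have "g ` (As ! i) = defset (\<psi>s ! i) (ys ! i) N v" if "i < length \<psi>s" for i
  proof -
    have "g ` f ` defset (\<psi>s ! i) (ys ! i) N v = defset (\<psi>s ! i) (ys ! i) N v"
      using sub that gf by (force simp: image_iff)
    then show ?thesis using im that by simp
  qed
  ultimately show "\<exists>g. embedding g M N \<and> g ` univ M = ?B \<and>
      (\<forall>i<length \<psi>s. g ` (As ! i) = defset (\<psi>s ! i) (ys ! i) N v)" by blast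
next
  let ?B = "defset \<phi> x N v" and ?R = "reduct (voc M) N"
  assume "\<exists>g. embedding g M N \<and> g ` univ M = ?B \<and>
      (\<forall>i<length \<psi>s. g ` (As ! i) = defset (\<psi>s ! i) (ys ! i) N v)"
  then obtain g where g: "embedding g M N" "g ` univ M = ?B"
    and im: "\<forall>i<length \<psi>s. g ` (As ! i) = defset (\<psi>s ! i) (ys ! i) N v" by blast
  have M: "is_struct M" and sv: "sub_vocab (voc M) (voc N)"
    and As: "\<And>i. i < length \<psi>s \<Longrightarrow> As ! i \<subseteq> univ M" using ok by auto
  have subf: "fun_ar (voc N) f = Some n" if "fun_ar (voc M) f = Some n" for f n
    using sv that by (auto simp: sub_vocab_def map_le_def dom_def)
  have subr: "rel_ar (voc N) f = Some n" if "rel_ar (voc M) f = Some n" for f n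
    using sv that by (auto simp: sub_vocab_def map_le_def dom_def)
  define f where "f = inv_into (univ M) g"
  \<comment> \<open>The set \<open>?B\<close> is closed under the functions named in
    \<open>voc M\<close>, being carried over from \<open>M\<close> by \<open>g\<close>, but perhaps
    not under the other functions of \<open>N\<close>; hence the reduct comes before the
    restriction.\<close>
  define N0 where "N0 = restrict_struct ?R ?B"
  have inj: "inj_on g (univ M)" using g by (simp add: embedding_def)
  then have fg: "f (g a) = a" if "a \<in> univ M" for a using that by (simp add: f_def)
  have f: "f b \<in> univ M" "g (f b) = b" if "b \<in> ?B" for b
    using that g(2) by (auto simp: f_def inv_into_into f_inv_into_f)
  have mapf: "set (map f xs) \<subseteq> univ M" "map g (map f xs) = xs" if "set xs \<subseteq> ?B" for xs
    using that f by (auto simp: subset_iff intro!: map_idI)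
  have BN: "?B \<subseteq> univ N" by (auto simp: solutions_def)
  have fnN: "fn N c xs = g (fn M c (map f xs))"
    if "fun_ar (voc M) c = Some (length xs)" "set xs \<subseteq> ?B" for c xs
    using g(1) that(1) mapf[OF that(2)] unfolding embedding_def by (metis length_map)
  have rlN: "rl N c xs = rl M c (map f xs)"
    if "rel_ar (voc M) c = Some (length xs)" "set xs \<subseteq> ?B" for c xs
    using g(1) that(1) mapf[OF that(2)] unfolding embedding_def by (metis length_map)
  have fnB: "fn N c xs \<in> ?B"
    if "fun_ar (voc M) c = Some (length xs)" "set xs \<subseteq> ?B" for c xs
  proof -
    have "fn M c (map f xs) \<in> univ M"
      using that mapf by (intro fn_closed[OF M]) auto
    then show ?thesis using fnN[OF that] g(2) by auto
  qed
  have R: "is_struct ?R"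
    unfolding is_struct_def
  proof (intro conjI allI impI)
    fix c xs assume "fun_ar (voc ?R) c = Some (length xs) \<and> set xs \<subseteq> univ ?R"
    then show "fn ?R c xs \<in> univ ?R"
      using fn_closed[OF N subf, of c xs] by (auto simp: reduct_def)
  next
    fix c xs assume *: "\<not> (fun_ar (voc ?R) c = Some (length xs) \<and> set xs \<subseteq> univ ?R)"
    show "fn ?R c xs = undefined"
    proof (cases "fun_ar (voc M) c")
      case (Some n)
      then have "\<not> (fun_ar (voc N) c = Some (length xs) \<and> set xs \<subseteq> univ N)"
        using * subf[OF Some] by (auto simp: reduct_def)
      then show ?thesis using N Some by (simp add: is_struct_def reduct_def dom_def)
    qed (auto simp: reduct_def dom_def)
  next
    fix c xs assume *: "rl ?R c xs"
    then have "rl N c xs" "c \<in> dom (rel_ar (voc M))" by (auto simp: reduct_def)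
    then show "rel_ar (voc ?R) c = Some (length xs)" "set xs \<subseteq> univ ?R"
      using subr N by (fastforce simp: is_struct_def reduct_def dom_def)+
  qed
  have N0: "is_struct N0"
    unfolding is_struct_def
  proof (intro conjI allI impI)
    fix c xs assume "fun_ar (voc N0) c = Some (length xs) \<and> set xs \<subseteq> univ N0"
    then show "fn N0 c xs \<in> univ N0"
      using fnB[of c xs] by (auto simp: N0_def reduct_def restrict_struct_def)
  next
    fix c xs assume *: "\<not> (fun_ar (voc N0) c = Some (length xs) \<and> set xs \<subseteq> univ N0)"
    show "fn N0 c xs = undefined"
    proof (cases "set xs \<subseteq> ?B")
      case True
      with * have "\<not> (fun_ar (voc ?R) c = Some (length xs) \<and> set xs \<subseteq> univ ?R)"
        by (simp add: N0_def restrict_struct_def)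
      then have "fn ?R c xs = undefined" using R unfolding is_struct_def by blast
      then show ?thesis by (simp add: N0_def restrict_struct_def)
    qed (simp add: N0_def restrict_struct_def)
  next
    fix c xs assume *: "rl N0 c xs"
    then have "rl ?R c xs" "set xs \<subseteq> ?B" by (auto simp: N0_def restrict_struct_def)
    then show "rel_ar (voc N0) c = Some (length xs)" "set xs \<subseteq> univ N0"
      using R by (auto simp: is_struct_def N0_def restrict_struct_def)
  qed
  have "substruct N0 ?R"
    using R N0 BN by (auto simp: substruct_def N0_def restrict_struct_def reduct_def)
  moreover have "univ N0 = ?B" by (simp add: N0_def restrict_struct_def)
  moreover have "is_iso f N0 M"
    unfolding is_iso_def
  proof (intro conjI allI impI; (elim conjE)?)
    show "voc N0 = voc M" by (simp add: N0_def restrict_struct_def reduct_def)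
    show "bij_betw f (univ N0) (univ M)"
      using inj_on_imp_bij_betw[OF inj] g(2) bij_betw_inv_into
      by (fastforce simp: f_def N0_def restrict_struct_def)
  next
    fix c xs assume *: "fun_ar (voc N0) c = Some (length xs)" "set xs \<subseteq> univ N0"
    then have ar: "fun_ar (voc M) c = Some (length xs)" and s: "set xs \<subseteq> ?B"
      by (simp_all add: N0_def restrict_struct_def reduct_def)
    have "fn M c (map f xs) \<in> univ M"
      using ar mapf[OF s] by (intro fn_closed[OF M]) auto
    then show "f (fn N0 c xs) = fn M c (map f xs)"
      using fnN[OF ar s] fg ar s by (simp add: N0_def restrict_struct_def reduct_def dom_def)
  next
    fix c xs assume *: "rel_ar (voc N0) c = Some (length xs)" "set xs \<subseteq> univ N0"
    then have ar: "rel_ar (voc M) c = Some (length xs)" and s: "set xs \<subseteq> ?B"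
      by (simp_all add: N0_def restrict_struct_def reduct_def)
    then show "rl N0 c xs = rl M c (map f xs)"
      using rlN[OF ar s] by (simp add: N0_def restrict_struct_def reduct_def dom_def)
  qed (use N0 M in auto)
  moreover have "f ` defset (\<psi>s ! i) (ys ! i) N v = As ! i" if "i < length \<psi>s" for i
  proof -
    have "f ` g ` (As ! i) = As ! i" using As[OF that] fg by (force simp: image_iff)
    then show ?thesis using im that by simp
  qed
  \<comment> \<open>The embedding form has no separate clause (i), as well-formedness already gives
    \<open>As ! i \<subseteq> univ M\<close>.\<close>
  moreover have "defset (\<psi>s ! i) (ys ! i) N v \<subseteq> ?B" if "i < length \<psi>s" for i
    using im that As[OF that] g(2) by blast
  ultimately show "sat (Qstruct M As x ys \<phi> \<psi>s) N v"
    unfolding sat_Qstruct by blast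
qed

text \<open>The last two hypotheses say that N2 has no solutions outside the image, so
  \<open>h\<close> matches the solution sets exactly. An embedding of \<open>M\<close> into N1 is
  then composed with \<open>h\<close>, and one into N2 is factored through \<open>h\<close>.\<close>

lemma embedding_sat_Qstruct:
  assumes h: "embedding h N1 N2" and N1: "is_struct N1" and N2: "is_struct N2" and voc: "voc N1 = voc N2"
    and ok: "fm_ok \<kappa> (voc N1) (Qstruct M As x ys \<phi> \<psi>s)"
    and qf: "qfree \<phi>" "\<forall>\<psi>\<in>set \<psi>s. qfree \<psi>"
    and v: "v ` fv (Qstruct M As x ys \<phi> \<psi>s) \<subseteq> univ N1"
    and \<phi>: "defset \<phi> x N2 (h \<circ> v) \<subseteq> h ` univ N1"
    and \<psi>: "\<forall>i<length \<psi>s. defset (\<psi>s ! i) (ys ! i) N2 (h \<circ> v) \<subseteq> h ` univ N1"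
  shows "sat (Qstruct M As x ys \<phi> \<psi>s) N2 (h \<circ> v) = sat (Qstruct M As x ys \<phi> \<psi>s) N1 v"
proof -
  have M: "is_struct M" and sv: "sub_vocab (voc M) (voc N1)" "sub_vocab (voc M) (voc N2)"
    and len: "length ys = length \<psi>s" "length As = length \<psi>s"
    and As: "\<And>i. i < length \<psi>s \<Longrightarrow> As ! i \<subseteq> univ M" using ok voc by auto
  note fv = fv_Qstruct[OF len(1)]
  have e\<phi>: "h ` defset \<phi> x N1 v = defset \<phi> x N2 (h \<circ> v)"
  proof -
    have "v ` (fv \<phi> - {x}) \<subseteq> univ N1" using v unfolding fv by blast
    moreover have "fm_ok \<kappa> (voc N1) \<phi>" using ok by simp
    ultimately have "h ` defset \<phi> x N1 v = defset \<phi> x N2 (h \<circ> v) \<inter> h ` univ N1"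
      by (intro embedding_defset[OF h N1 qf(1)])
    then show ?thesis using \<phi> by (simp only: Int_absorb2)
  qed
  have e\<psi>: "h ` defset (\<psi>s ! i) (ys ! i) N1 v = defset (\<psi>s ! i) (ys ! i) N2 (h \<circ> v)"
    if "i < length \<psi>s" for i
  proof -
    have "v ` (fv (\<psi>s ! i) - {ys ! i}) \<subseteq> univ N1" using v that unfolding fv by blast
    moreover have "fm_ok \<kappa> (voc N1) (\<psi>s ! i)" "qfree (\<psi>s ! i)" using ok qf(2) that by auto
    ultimately have "h ` defset (\<psi>s ! i) (ys ! i) N1 v =
        defset (\<psi>s ! i) (ys ! i) N2 (h \<circ> v) \<inter> h ` univ N1"
      by (intro embedding_defset[OF h N1])
    then show ?thesis using \<psi> that by (simp only: Int_absorb2)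
  qed
  have inj: "inj_on h (univ N1)" using h by (simp add: embedding_def)
  have D: "defset \<chi> y N1 v \<subseteq> univ N1" for \<chi> y by (auto simp: solutions_def)
  show ?thesis
    unfolding sat_Qstruct_embedding[OF ok N1] sat_Qstruct_embedding[OF ok[unfolded voc] N2]
  proof
    assume "\<exists>g. embedding g M N1 \<and> g ` univ M = defset \<phi> x N1 v \<and>
      (\<forall>i<length \<psi>s. g ` (As ! i) = defset (\<psi>s ! i) (ys ! i) N1 v)"
    then obtain g where g: "embedding g M N1" "g ` univ M = defset \<phi> x N1 v"
      "\<forall>i<length \<psi>s. g ` (As ! i) = defset (\<psi>s ! i) (ys ! i) N1 v" by blast
    show "\<exists>g. embedding g M N2 \<and> g ` univ M = defset \<phi> x N2 (h \<circ> v) \<and>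
      (\<forall>i<length \<psi>s. g ` (As ! i) = defset (\<psi>s ! i) (ys ! i) N2 (h \<circ> v))"
    proof (intro exI[of _ "h \<circ> g"] conjI allI impI)
      show "embedding (h \<circ> g) M N2" using embedding_comp[OF g(1) h sv(1)] .
      show "(h \<circ> g) ` univ M = defset \<phi> x N2 (h \<circ> v)" using g(2) e\<phi> by (metis image_comp)
      show "(h \<circ> g) ` (As ! i) = defset (\<psi>s ! i) (ys ! i) N2 (h \<circ> v)" if "i < length \<psi>s" for i
        using g(3) e\<psi>[OF that] that by (metis image_comp)
    qed
  next
    assume "\<exists>g. embedding g M N2 \<and> g ` univ M = defset \<phi> x N2 (h \<circ> v) \<and>
      (\<forall>i<length \<psi>s. g ` (As ! i) = defset (\<psi>s ! i) (ys ! i) N2 (h \<circ> v))"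
    then obtain g where g: "embedding g M N2" "g ` univ M = defset \<phi> x N2 (h \<circ> v)"
      "\<forall>i<length \<psi>s. g ` (As ! i) = defset (\<psi>s ! i) (ys ! i) N2 (h \<circ> v)" by blast
    let ?k = "inv_into (univ N1) h"
    have k: "?k ` h ` X = X" if "X \<subseteq> univ N1" for X
      using that inj by (simp add: inv_into_image_cancel)
    have "embedding (?k \<circ> g) M N1"
      using \<phi> g(2) by (intro embedding_factor[OF M N1 g(1) h sv(1)]) simp
    moreover have "(?k \<circ> g) ` univ M = defset \<phi> x N1 v"
      unfolding image_comp[symmetric] g(2) e\<phi>[symmetric] by (intro k D)
    moreover have "(?k \<circ> g) ` (As ! i) = defset (\<psi>s ! i) (ys ! i) N1 v" if "i < length \<psi>s" for i
      using g(3) e\<psi>[OF that] k[OF D] that by (metis image_comp)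
    ultimately show "\<exists>g. embedding g M N1 \<and> g ` univ M = defset \<phi> x N1 v \<and>
      (\<forall>i<length \<psi>s. g ` (As ! i) = defset (\<psi>s ! i) (ys ! i) N1 v)" by blast
  qed
qed

section \<open>Closed subsets of models\<close>

text \<open>The solution sets are evaluated in \<open>N\<close>, not in the restriction to
  \<open>B\<close>. The sets defined by the \<psi>s are listed separately because the notion is also
  applied to a union of a chain before it is known to be a model, when they are not yet known to lie
  inside the set defined by \<phi>.\<close>

definition closed_in :: "('f, 'r, 'k, 'i) fm set \<Rightarrow> ('f, 'r, 'a) struct \<Rightarrow> 'a set \<Rightarrow> bool" where
  "closed_in F N B \<longleftrightarrow>
    B \<subseteq> univ N \<and>
    (\<forall>f xs. fun_ar (voc N) f = Some (length xs) \<and> set xs \<subseteq> B \<longrightarrow> fn N f xs \<in> B) \<and>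
    (\<forall>M As x ys \<phi> \<psi>s v.
      Qstruct M As x ys \<phi> \<psi>s \<in> F \<and> v ` fv (Qstruct M As x ys \<phi> \<psi>s) \<subseteq> B \<longrightarrow>
        defset \<phi> x N v \<subseteq> B \<and> (\<forall>i<length \<psi>s. defset (\<psi>s ! i) (ys ! i) N v \<subseteq> B))"

lemma closed_in_univ: "is_struct N \<Longrightarrow> closed_in F N (univ N)"
  by (auto simp: closed_in_def is_struct_def solutions_def)

lemma closed_inI:
  assumes sub: "substruct M N"
    and Q: "\<And>M' As x ys \<phi> \<psi>s v. Qstruct M' As x ys \<phi> \<psi>s \<in> F \<Longrightarrow>
      v ` fv (Qstruct M' As x ys \<phi> \<psi>s) \<subseteq> univ M \<Longrightarrow>
      defset \<phi> x N v \<subseteq> univ M \<and> (\<forall>i<length \<psi>s. defset (\<psi>s ! i) (ys ! i) N v \<subseteq> univ M)"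
  shows "closed_in F N (univ M)"
proof -
  have 1: "univ M \<subseteq> univ N" using sub by (simp add: substruct_def)
  have 2: "fn N f xs \<in> univ M"
    if "fun_ar (voc N) f = Some (length xs)" "set xs \<subseteq> univ M" for f xs
    using that sub fn_closed[of M f xs] by (simp add: substruct_def)
  show ?thesis
    unfolding closed_in_def
    by (intro conjI; (intro allI impI; elim conjE)?) ((rule 1 | rule 2 | rule Q); assumption?)+
qed

text \<open>What a tuple forces into a closed set is computed in \<open>N\<close> and so is the same
  for every member of the family.\<close>

lemma closed_in_Inter:
  assumes "\<B> \<noteq> {}" and closed: "\<And>B. B \<in> \<B> \<Longrightarrow> closed_in F N B"
  shows "closed_in F N (\<Inter>\<B>)"
  unfolding closed_in_def
proof (intro conjI allI impI; (elim conjE)?)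
  show "\<Inter>\<B> \<subseteq> univ N" using assms unfolding closed_in_def by blast
next
  fix f xs assume "fun_ar (voc N) f = Some (length xs)" "set xs \<subseteq> \<Inter>\<B>"
  then show "fn N f xs \<in> \<Inter>\<B>" using closed unfolding closed_in_def by blast
next
  fix M As x ys \<phi> \<psi>s v
  assume Q: "Qstruct M As x ys \<phi> \<psi>s \<in> F" "v ` fv (Qstruct M As x ys \<phi> \<psi>s) \<subseteq> \<Inter>\<B>"
  have "defset \<phi> x N v \<subseteq> B \<and> (\<forall>i<length \<psi>s. defset (\<psi>s ! i) (ys ! i) N v \<subseteq> B)" if "B \<in> \<B>" for B
  proof -
    have "v ` fv (Qstruct M As x ys \<phi> \<psi>s) \<subseteq> B" using Q(2) that by blast
    then show ?thesis using closed[OF that] Q(1) unfolding closed_in_def by blast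
  qed
  then show "defset \<phi> x N v \<subseteq> \<Inter>\<B>"
    and "\<And>i. i < length \<psi>s \<Longrightarrow> defset (\<psi>s ! i) (ys ! i) N v \<subseteq> \<Inter>\<B>" by blast+
qed

lemma closed_in_Qstruct:
  assumes "closed_in F N B" and "Qstruct M As x ys \<phi> \<psi>s \<in> F"
    and "v ` fv (Qstruct M As x ys \<phi> \<psi>s) \<subseteq> B"
  shows "defset \<phi> x N v \<subseteq> B" and "\<forall>i<length \<psi>s. defset (\<psi>s ! i) (ys ! i) N v \<subseteq> B"
  using assms unfolding closed_in_def by blast+

lemma restrict_substruct:
  assumes "is_struct N" and "closed_in F N B"
  shows "substruct (restrict_struct N B) N"
proof -
  have "is_struct (restrict_struct N B)"
    unfolding is_struct_def
  proof (intro conjI allI impI)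
    fix f xs assume "fun_ar (voc (restrict_struct N B)) f = Some (length xs) \<and> set xs \<subseteq> univ (restrict_struct N B)"
    then show "fn (restrict_struct N B) f xs \<in> univ (restrict_struct N B)"
      using assms(2) unfolding restrict_struct_def closed_in_def by auto
  next
    fix f xs assume "\<not> (fun_ar (voc (restrict_struct N B)) f = Some (length xs) \<and> set xs \<subseteq> univ (restrict_struct N B))"
    then show "fn (restrict_struct N B) f xs = undefined"
      using assms(1) by (auto simp: restrict_struct_def is_struct_def)
  next
    fix r xs assume "rl (restrict_struct N B) r xs"
    then show "rel_ar (voc (restrict_struct N B)) r = Some (length xs)" "set xs \<subseteq> univ (restrict_struct N B)"
      using assms(1) by (auto simp: restrict_struct_def is_struct_def)
  qed
  then show ?thesis
    using assms by (auto simp: substruct_def restrict_struct_def closed_in_def)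
qed

lemma is_iso_inv:
  assumes "is_iso h M N"
  shows "is_iso (inv_into (univ M) h) N M"
proof -
  let ?k = "inv_into (univ M) h"
  have M: "is_struct M" and N: "is_struct N" and voc: "voc M = voc N"
    and bij: "bij_betw h (univ M) (univ N)" using assms by (auto simp: is_iso_def)
  \<comment> \<open>The inverse is the identity of \<open>N\<close> factored through
    \<open>h\<close>.\<close>
  have emb: "embedding ?k N M"
  proof -
    have "embedding id N N" by (auto simp: embedding_def)
    from embedding_factor[OF N M this is_iso_embedding[OF assms]] show ?thesis
      using bij voc by (simp add: sub_vocab_def bij_betw_def)
  qed
  then show ?thesis
    using M N voc bij_betw_inv_into[OF bij] unfolding is_iso_def embedding_def by simp
qed

lemma substruct_antisym:
  assumes "substruct M N" and "substruct N M"
  shows "M = N"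
proof -
  have st: "is_struct M" "is_struct N" using assms by (auto simp: substruct_def)
  have u: "univ M = univ N" and v: "voc M = voc N" using assms by (auto simp: substruct_def)
  have "fn M f xs = fn N f xs" for f xs
  proof (cases "fun_ar (voc M) f = Some (length xs) \<and> set xs \<subseteq> univ M")
    case True
    then show ?thesis using assms(1) unfolding substruct_def by blast
  next
    case False
    then have "fn M f xs = undefined" "fn N f xs = undefined"
      using st u v unfolding is_struct_def by auto
    then show ?thesis by simp
  qed
  moreover have "rl M r xs = rl N r xs" for r xs
  proof (cases "rel_ar (voc M) r = Some (length xs) \<and> set xs \<subseteq> univ M")
    case True
    then show ?thesis using assms(1) unfolding substruct_def by blast
  next
    case False
    then have "\<not> rl M r xs" "\<not> rl N r xs"
      using st u v unfolding is_struct_def by metis+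
    then show ?thesis by simp
  qed
  ultimately show ?thesis using u v by (intro struct.equality ext) auto
qed

lemma substruct_trans: "substruct M N \<Longrightarrow> substruct N P \<Longrightarrow> substruct M P"
  unfolding substruct_def by (auto; blast)

lemma substruct_defset:
  assumes "substruct N1 N2" and "qfree \<phi>" "fm_ok \<kappa> (voc N1) \<phi>" and "v ` (fv \<phi> - {x}) \<subseteq> univ N1"
  shows "defset \<phi> x N1 v = defset \<phi> x N2 v \<inter> univ N1"
  using embedding_defset[OF substruct_embedding[OF assms(1)] _ assms(2-4)] assms(1)
  by (simp add: substruct_def)

section \<open>The formulas of the smallest fragment\<close>

locale forall_Q_fragment =
  fixes \<kappa> :: "'k rel"
    and \<tau> :: "('f, 'r) vocab"
    and T F :: "('f, 'r, 'k, 'i) fm set"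
  assumes Card_order: "Card_order \<kappa>"
    and cinfinite: "cinfinite \<kappa>"
    and theory_T: "forall_Q_theory \<kappa> \<tau> T"
    and fragment_F: "smallest_fragment \<kappa> \<tau> T F"
begin

lemma F_ok: "\<phi> \<in> F \<Longrightarrow> fm_ok \<kappa> \<tau> \<phi>"
  using fragment_F by (auto simp: smallest_fragment_def fragment_def)

lemma F_atomic: "atomic \<phi> \<Longrightarrow> fm_ok \<kappa> \<tau> \<phi> \<Longrightarrow> \<phi> \<in> F"
  using fragment_F by (auto simp: smallest_fragment_def fragment_def)

lemma F_subfm: "\<phi> \<in> F \<Longrightarrow> \<psi> \<in> immediate_subfms \<phi> \<Longrightarrow> \<psi> \<in> F"
  using fragment_F unfolding smallest_fragment_def fragment_def by blast

lemma T_F: "\<sigma> \<in> T \<Longrightarrow> \<sigma> \<in> F"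
  using fragment_F by (auto simp: smallest_fragment_def)

text \<open>The disjuncts differ only in \<open>M\<close> and \<open>As\<close>; the variables and
  the formulas \<phi>, \<psi>s are common to all. Hence whichever disjunct is true, it gives
  information about the sets defined by every other one.\<close>

definition matrix ::
  "('i \<Rightarrow> ('f, 'r, 'k, 'i) fm option) \<Rightarrow> nat \<Rightarrow> nat list \<Rightarrow>
    ('f, 'r, 'k, 'i) fm \<Rightarrow> ('f, 'r, 'k, 'i) fm list \<Rightarrow> bool" where
  "matrix \<Phi> x ys \<phi> \<psi>s \<longleftrightarrow>
    (\<forall>\<chi>\<in>ran \<Phi>. \<exists>M As. \<chi> = Qstruct M As x ys \<phi> \<psi>s) \<and> qfree \<phi> \<and> (\<forall>\<psi>\<in>set \<psi>s. qfree \<psi>)"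

lemma T_cases:
  assumes "\<sigma> \<in> T"
  obtains zs \<Phi> x ys \<phi> \<psi>s where "\<sigma> = foldr All zs (Disj \<Phi>)" and "matrix \<Phi> x ys \<phi> \<psi>s"
proof -
  have "forall_Q_sentence \<kappa> \<tau> \<sigma>" using theory_T assms by (auto simp: forall_Q_theory_def)
  then obtain zs \<Phi> S x ys \<phi> \<psi>s where \<sigma>: "\<sigma> = foldr All zs (Disj \<Phi>)" and "S \<noteq> {}"
    and "ran \<Phi> = {Qstruct M As x ys \<phi> \<psi>s | M As. (M, As) \<in> S}"
    and "qfree \<phi>" "\<forall>\<psi>\<in>set \<psi>s. qfree \<psi>"
    unfolding forall_Q_sentence_def by (elim conjE exE) (rule that)
  then have "matrix \<Phi> x ys \<phi> \<psi>s" unfolding matrix_def by blast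
  with \<sigma> show thesis by (rule that)
qed

text \<open>By minimality of \<open>F\<close>: its members of these three kinds already form a
  fragment containing \<open>T\<close>. In the third case the discarded prefix \<open>zs\<close> is
  remembered, so that the whole sentence is available in models; an empty \<open>zs'\<close> gives
  the disjunction itself.\<close>

lemma F_cases:
  assumes "\<chi> \<in> F"
  obtains (qfree) "qfree \<chi>"
  | (Qstruct) zs \<Phi> M As x ys \<phi> \<psi>s where "foldr All zs (Disj \<Phi>) \<in> T" "matrix \<Phi> x ys \<phi> \<psi>s"
      "\<chi> \<in> ran \<Phi>" "\<chi> = Qstruct M As x ys \<phi> \<psi>s"
  | (All) zs zs' \<Phi> x ys \<phi> \<psi>s where "foldr All (zs @ zs') (Disj \<Phi>) \<in> T" "matrix \<Phi> x ys \<phi> \<psi>s"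
      "\<chi> = foldr All zs' (Disj \<Phi>)"
proof -
  define P1 where "P1 \<chi> \<longleftrightarrow> (\<exists>zs \<Phi> M As x ys \<phi> \<psi>s. foldr All zs (Disj \<Phi>) \<in> T \<and>
    matrix \<Phi> x ys \<phi> \<psi>s \<and> \<chi> \<in> ran \<Phi> \<and> \<chi> = Qstruct M As x ys \<phi> \<psi>s)" for \<chi>
  define P2 where "P2 \<chi> \<longleftrightarrow> (\<exists>zs zs' \<Phi> x ys \<phi> \<psi>s. foldr All (zs @ zs') (Disj \<Phi>) \<in> T \<and>
    matrix \<Phi> x ys \<phi> \<psi>s \<and> \<chi> = foldr All zs' (Disj \<Phi>))" for \<chi>
  define G where "G = {\<chi> \<in> F. qfree \<chi> \<or> P1 \<chi> \<or> P2 \<chi>}"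
  have "\<psi> \<in> G" if \<chi>: "\<chi> \<in> G" and \<psi>: "\<psi> \<in> immediate_subfms \<chi>" for \<chi> \<psi>
  proof -
    have F: "\<psi> \<in> F" using \<chi> \<psi> F_subfm by (auto simp: G_def)
    consider "qfree \<chi>" | "P1 \<chi>" | "P2 \<chi>" using \<chi> by (auto simp: G_def)
    then have "qfree \<psi> \<or> P1 \<psi> \<or> P2 \<psi>"
    proof cases
      case 1
      then show ?thesis using \<psi> by (cases \<chi>) (auto simp: qfree_Conj_Disj simp del: qfree.simps(4,5))
    next
      case 2
      then show ?thesis using \<psi> by (auto simp: P1_def matrix_def)
    next
      case 3
      then obtain zs zs' \<Phi> x ys \<phi> \<psi>s where *: "foldr All (zs @ zs') (Disj \<Phi>) \<in> T"
        "matrix \<Phi> x ys \<phi> \<psi>s" "\<chi> = foldr All zs' (Disj \<Phi>)" unfolding P2_def by blast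
      show ?thesis
      proof (cases zs')
        case Nil
        then have "\<psi> \<in> ran \<Phi>" using \<psi> * by simp
        moreover from this obtain M As where "\<psi> = Qstruct M As x ys \<phi> \<psi>s"
          using *(2) unfolding matrix_def by blast
        ultimately have "P1 \<psi>" using * unfolding P1_def by blast
        then show ?thesis by simp
      next
        case (Cons z zs'')
        then have "\<psi> = foldr All zs'' (Disj \<Phi>)" "foldr All ((zs @ [z]) @ zs'') (Disj \<Phi>) \<in> T"
          using \<psi> * by simp_all
        then have "P2 \<psi>" using *(2) unfolding P2_def by blast
        then show ?thesis by simp
      qed
    qed
    with F show ?thesis by (simp add: G_def)
  qed
  moreover have "\<forall>\<chi>. atomic \<chi> \<and> fm_ok \<kappa> \<tau> \<chi> \<longrightarrow> \<chi> \<in> G"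
    using F_atomic by (auto simp: G_def atomic_def)
  moreover have "\<forall>\<chi>\<in>G. fm_ok \<kappa> \<tau> \<chi>" using F_ok by (simp add: G_def)
  ultimately have "fragment \<kappa> \<tau> G" unfolding fragment_def by blast
  moreover have "T \<subseteq> G"
  proof
    fix \<sigma> assume \<sigma>: "\<sigma> \<in> T"
    then obtain zs \<Phi> x ys \<phi> \<psi>s where \<sigma>_eq: "\<sigma> = foldr All zs (Disj \<Phi>)"
      and "matrix \<Phi> x ys \<phi> \<psi>s" by (rule T_cases)
    moreover have "foldr All ([] @ zs) (Disj \<Phi>) \<in> T" using \<sigma> \<sigma>_eq by simp
    ultimately have "P2 \<sigma>" using \<sigma>_eq unfolding P2_def by blast
    then show "\<sigma> \<in> G" using \<sigma> T_F by (auto simp: G_def)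
  qed
  ultimately have "F \<subseteq> G" using fragment_F by (simp add: smallest_fragment_def)
  then have "qfree \<chi> \<or> P1 \<chi> \<or> P2 \<chi>" using assms by (auto simp: G_def)
  then show thesis
  proof (elim disjE)
    assume "P1 \<chi>"
    then show thesis unfolding P1_def by (elim exE conjE) (rule Qstruct)
  next
    assume "P2 \<chi>"
    then show thesis unfolding P2_def by (elim exE conjE) (rule All)
  qed (rule qfree)
qed

lemma F_Qstruct:
  assumes "Qstruct M As x ys \<phi> \<psi>s \<in> F"
  obtains zs \<Phi> where "foldr All zs (Disj \<Phi>) \<in> T" "matrix \<Phi> x ys \<phi> \<psi>s"
    "Qstruct M As x ys \<phi> \<psi>s \<in> ran \<Phi>"
  using assms
proof (cases rule: F_cases)
  case (Qstruct zs \<Phi> M' As' x' ys' \<phi>' \<psi>s')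
  then show thesis using that[of zs \<Phi>] by simp
next
  case (All zs zs' \<Phi> x ys \<phi> \<psi>s)
  then show thesis by (cases zs') simp_all
qed simp

lemma F_Qstruct_qfree:
  assumes "Qstruct M As x ys \<phi> \<psi>s \<in> F"
  shows "qfree \<phi>" and "\<forall>\<psi>\<in>set \<psi>s. qfree \<psi>"
proof -
  obtain \<Phi> where "matrix \<Phi> x ys \<phi> \<psi>s" using F_Qstruct[OF assms] .
  then show "qfree \<phi>" "\<forall>\<psi>\<in>set \<psi>s. qfree \<psi>" by (simp_all add: matrix_def)
qed

lemma matrix_F: "foldr All zs (Disj \<Phi>) \<in> T \<Longrightarrow> Disj \<Phi> \<in> F"
proof -
  have "Disj \<Phi> \<in> F" if "foldr All zs (Disj \<Phi>) \<in> F"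
    using that
  proof (induction zs)
    case (Cons z zs)
    then show ?case using F_subfm[of "foldr All (z # zs) (Disj \<Phi>)"] by simp
  qed simp
  then show "foldr All zs (Disj \<Phi>) \<in> T \<Longrightarrow> Disj \<Phi> \<in> F" by (simp add: T_F)
qed

lemma F_Qstruct_fv:
  assumes "Qstruct M As x ys \<phi> \<psi>s \<in> F"
  shows "fv (Qstruct M As x ys \<phi> \<psi>s) =
    (fv \<phi> - {x}) \<union> (\<Union>i<length \<psi>s. fv (\<psi>s ! i) - {ys ! i})"
  using F_ok[OF assms] by (intro fv_Qstruct) simp

section \<open>Solution sets in models, and transfer of truth along embeddings with closed
  image\<close>

lemma Mod_struct: "N \<in> Mod \<tau> T \<Longrightarrow> is_struct N" "N \<in> Mod \<tau> T \<Longrightarrow> voc N = \<tau>"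
  by (auto simp: Mod_def)

lemma Mod_sat_matrix:
  assumes "N \<in> Mod \<tau> T" and T: "foldr All zs (Disj \<Phi>) \<in> T"
    and v: "v ` fv (Disj \<Phi>) \<subseteq> univ N" and "univ N \<noteq> {}"
  shows "sat (Disj \<Phi>) N v"
proof -
  obtain c where c: "c \<in> univ N" using assms(4) by blast
  \<comment> \<open>The sentence speaks of assignments that send all of \<open>zs\<close> into the
    universe, while \<open>v\<close> is controlled only on the free variables of the disjunction.
    The others are sent to an arbitrary element, which needs a non-empty universe.\<close>
  define w where "w z = (if z \<in> fv (Disj \<Phi>) then v z else c)" for z
  have "sat (foldr All zs (Disj \<Phi>)) N w" using assms by (simp add: Mod_def)
  moreover have "w ` set zs \<subseteq> univ N" using v c by (auto simp: w_def simp del: fv.simps)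
  ultimately have "sat (Disj \<Phi>) N w" unfolding sat_foldr_All by blast
  then show ?thesis
    using sat_cong[OF F_ok[OF matrix_F[OF T]], of v w N] by (simp add: w_def del: fv.simps)
qed

text \<open>The disjunct true at \<open>v\<close> may have a structure \<open>M'\<close> other than
  \<open>M\<close>, but it has the same \<phi> and \<psi>s, so its embedding maps
  \<open>univ M'\<close> onto the set defined by \<phi>. This discharges the size proviso of the
  order.\<close>

lemma Mod_defset:
  assumes N: "N \<in> Mod \<tau> T" and Q: "Qstruct M As x ys \<phi> \<psi>s \<in> F"
    and v: "v ` fv (Qstruct M As x ys \<phi> \<psi>s) \<subseteq> univ N"
  shows "|defset \<phi> x N v| <o \<kappa>"
    and "\<forall>i<length \<psi>s. defset (\<psi>s ! i) (ys ! i) N v \<subseteq> defset \<phi> x N v"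
proof -
  have "|defset \<phi> x N v| <o \<kappa> \<and>
    (\<forall>i<length \<psi>s. defset (\<psi>s ! i) (ys ! i) N v \<subseteq> defset \<phi> x N v)"
  proof (cases "univ N = {}")
    case True
    then have "defset \<chi> y N v = {}" for \<chi> :: "('f, 'r, 'k, 'i) fm" and y by (auto simp: solutions_def)
    moreover from this have "|defset \<phi> x N v| <o \<kappa>"
      using Card_order cinfinite by (intro finite_ordLess_Cinfinite) auto
    ultimately show ?thesis by simp
  next
    case False
    obtain zs \<Phi> where \<Phi>: "foldr All zs (Disj \<Phi>) \<in> T" "matrix \<Phi> x ys \<phi> \<psi>s"
      using F_Qstruct[OF Q] by blast
    have R: "\<exists>M As. \<chi> = Qstruct M As x ys \<phi> \<psi>s \<and> \<chi> \<in> F" if "\<chi> \<in> ran \<Phi>" for \<chi>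
      using \<Phi>(2) that F_subfm[OF matrix_F[OF \<Phi>(1)]] by (auto simp: matrix_def)
    \<comment> \<open>Free variables do not depend on \<open>M\<close> and \<open>As\<close>, so
      \<open>v\<close> is an admissible assignment for the entire disjunction.\<close>
    have "fv \<chi> \<subseteq> fv (Qstruct M As x ys \<phi> \<psi>s)" if \<chi>: "\<chi> \<in> ran \<Phi>" for \<chi>
    proof -
      obtain M' As' where "\<chi> = Qstruct M' As' x ys \<phi> \<psi>s" "Qstruct M' As' x ys \<phi> \<psi>s \<in> F"
        using R[OF \<chi>] by blast
      then show ?thesis by (simp only: F_Qstruct_fv[OF Q] F_Qstruct_fv order_refl)
    qed
    then have "fv (Disj \<Phi>) \<subseteq> fv (Qstruct M As x ys \<phi> \<psi>s)"
      unfolding fv_Conj_Disj by (rule UN_least)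
    from subset_trans[OF image_mono[OF this] v]
    have "sat (Disj \<Phi>) N v" using False by (rule Mod_sat_matrix[OF N \<Phi>(1)])
    then obtain M' As' where Q': "Qstruct M' As' x ys \<phi> \<psi>s \<in> F" "sat (Qstruct M' As' x ys \<phi> \<psi>s) N v"
      using R unfolding sat_Conj_Disj by blast
    have ok: "fm_ok \<kappa> \<tau> (Qstruct M' As' x ys \<phi> \<psi>s)" using F_ok Q' by blast
    then obtain g where g: "g ` univ M' = defset \<phi> x N v"
      "\<forall>i<length \<psi>s. g ` (As' ! i) = defset (\<psi>s ! i) (ys ! i) N v"
      using Q'(2) sat_Qstruct_embedding[of \<kappa> N M' As' x ys \<phi> \<psi>s v] Mod_struct[OF N] by auto
    obtain a where a: "a \<in> Field \<kappa>" "univ M' = underS \<kappa> a" using ok by auto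
    \<comment> \<open>A proper initial segment of a cardinal order has smaller cardinality.\<close>
    have "|univ M'| <o \<kappa>" using a Card_order by (simp add: card_of_underS)
    then have "|defset \<phi> x N v| <o \<kappa>" using g(1) by (metis card_of_image ordLeq_ordLess_trans)
    moreover have "defset (\<psi>s ! i) (ys ! i) N v \<subseteq> defset \<phi> x N v" if "i < length \<psi>s" for i
    proof -
      have "As' ! i \<subseteq> univ M'" using ok that by auto
      then show ?thesis using g that by blast
    qed
    ultimately show ?thesis by blast
  qed
  then show "|defset \<phi> x N v| <o \<kappa>"
    "\<forall>i<length \<psi>s. defset (\<psi>s ! i) (ys ! i) N v \<subseteq> defset \<phi> x N v" by blast+
qed

text \<open>Stated for arbitrary structures of the vocabulary: for a union of a chain it serves to
  prove that the union is a model.\<close>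

lemma embedding_closed_sat_Qstruct:
  assumes h: "embedding h N1 N2" and N1: "is_struct N1" "voc N1 = \<tau>" and N2: "is_struct N2" "voc N2 = \<tau>"
    and closed: "closed_in F N2 (h ` univ N1)"
    and Q: "Qstruct M As x ys \<phi> \<psi>s \<in> F" and v: "v ` fv (Qstruct M As x ys \<phi> \<psi>s) \<subseteq> univ N1"
  shows "sat (Qstruct M As x ys \<phi> \<psi>s) N2 (h \<circ> v) = sat (Qstruct M As x ys \<phi> \<psi>s) N1 v"
proof -
  have "(h \<circ> v) ` fv (Qstruct M As x ys \<phi> \<psi>s) \<subseteq> h ` univ N1"
    using v by (auto simp del: fv.simps)
  from closed_in_Qstruct[OF closed Q this] show ?thesis
    using F_ok[OF Q] F_Qstruct_qfree[OF Q] N1 N2 v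
    by (intro embedding_sat_Qstruct[OF h N1(1) N2(1)]) (simp_all del: fm_ok.simps fv.simps)
qed

text \<open>Only N2 is assumed to be a model. Truth of universal formulas in N1 is obtained from N2
  through the disjunctions under the prefix, so the result can show that N1 is a model too.\<close>

lemma embedding_closed_sat:
  assumes h: "embedding h N1 N2" and N1: "is_struct N1" "voc N1 = \<tau>" and N2: "N2 \<in> Mod \<tau> T"
    and closed: "closed_in F N2 (h ` univ N1)"
    and \<chi>: "\<chi> \<in> F" and v: "v ` fv \<chi> \<subseteq> univ N1"
  shows "sat \<chi> N2 (h \<circ> v) = sat \<chi> N1 v"
  using \<chi>
proof (cases rule: F_cases)
  case qfree
  then show ?thesis using embedding_sat[OF h N1(1) qfree] F_ok[OF \<chi>] N1(2) v by auto
next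
  case (Qstruct zs \<Phi> M As x ys \<phi> \<psi>s)
  then show ?thesis
    using embedding_closed_sat_Qstruct[OF h N1 Mod_struct[OF N2] closed] \<chi> v by metis
next
  case (All zs zs' \<Phi> x ys \<phi> \<psi>s)
  text \<open>If \<open>N2\<close> is empty, a formula with a non-empty quantifier prefix holds vacuously in both
    structures; otherwise it holds in both since \<open>N2\<close> is a model of the sentence it comes from.\<close>
  have D: "sat (Disj \<Phi>) N2 (h \<circ> w) = sat (Disj \<Phi>) N1 w" if w: "w ` fv (Disj \<Phi>) \<subseteq> univ N1" for w
  proof -
    have "sat \<theta> N2 (h \<circ> w) = sat \<theta> N1 w" if \<theta>: "\<theta> \<in> ran \<Phi>" for \<theta>
    proof -
      obtain M As where "\<theta> = Qstruct M As x ys \<phi> \<psi>s" using All(2) \<theta> by (auto simp: matrix_def)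
      moreover have "\<theta> \<in> F" using \<theta> F_subfm[OF matrix_F[OF All(1)]] by simp
      moreover have "w ` fv \<theta> \<subseteq> univ N1" using w \<theta> unfolding fv_Conj_Disj by blast
      ultimately show ?thesis
        using embedding_closed_sat_Qstruct[OF h N1 Mod_struct[OF N2] closed] by metis
    qed
    then show ?thesis unfolding sat_Conj_Disj by blast
  qed
  have sub: "h ` univ N1 \<subseteq> univ N2" using h by (simp add: embedding_def)
  show ?thesis
  proof (cases "univ N2 = {}")
    case True
    show ?thesis
    proof (cases zs')
      \<comment> \<open>A bare disjunction is not vacuous even in an empty structure: a disjunct
        with non-empty \<open>M\<close> fails there. Hence it has to be compared by
        \<open>D\<close>.\<close>
      case Nil
      then show ?thesis using D v All(3) by (metis foldr.simps(1) id_apply)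
    next
      case (Cons z zs'')
      then show ?thesis using True sub All(3) by auto
    qed
  next
    case False
    have sat: "sat (Disj \<Phi>) N2 w" if "w ` fv (Disj \<Phi>) \<subseteq> univ N2" for w
      using Mod_sat_matrix[OF N2 All(1) that False] .
    \<comment> \<open>As \<open>zs'\<close> may be only a tail of the prefix, variables of the
      disjunction that it does not bind stay free in \<chi> and are controlled by
      \<open>v\<close>.\<close>
    have fv: "fv (Disj \<Phi>) \<subseteq> fv \<chi> \<union> set zs'"
      unfolding All(3) fv_foldr_All by blast
    have "sat \<chi> N2 (h \<circ> v)"
      unfolding All(3) sat_foldr_All
    proof (intro allI impI)
      fix w assume w: "w ` set zs' \<subseteq> univ N2 \<and> (\<forall>z. z \<notin> set zs' \<longrightarrow> w z = (h \<circ> v) z)"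
      have "w z \<in> univ N2" if "z \<in> fv (Disj \<Phi>)" for z
        using fv that w v sub by (cases "z \<in> set zs'") (auto simp del: fv.simps)
      then show "sat (Disj \<Phi>) N2 w" by (intro sat) blast
    qed
    moreover have "sat \<chi> N1 v"
      unfolding All(3) sat_foldr_All
    proof (intro allI impI)
      fix w assume w: "w ` set zs' \<subseteq> univ N1 \<and> (\<forall>z. z \<notin> set zs' \<longrightarrow> w z = v z)"
      have "w z \<in> univ N1" if "z \<in> fv (Disj \<Phi>)" for z
        using fv that w v by (cases "z \<in> set zs'") (auto simp del: fv.simps)
      then have *: "w ` fv (Disj \<Phi>) \<subseteq> univ N1" by blast
      moreover have "sat (Disj \<Phi>) N2 (h \<circ> w)" using * sub by (intro sat) fastforce
      ultimately show "sat (Disj \<Phi>) N1 w" using D by blast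
    qed
    ultimately show ?thesis by simp
  qed
qed

lemma T_fv: "\<sigma> \<in> T \<Longrightarrow> fv \<sigma> = {}"
  using theory_T by (auto simp: forall_Q_theory_def forall_Q_sentence_def)

lemma embedding_closed_Mod:
  assumes h: "embedding h N1 N2" and N1: "is_struct N1" "voc N1 = \<tau>" and N2: "N2 \<in> Mod \<tau> T"
    and closed: "closed_in F N2 (h ` univ N1)"
  shows "N1 \<in> Mod \<tau> T"
proof -
  have "sat \<sigma> N1 v" if "\<sigma> \<in> T" for \<sigma> v
    using embedding_closed_sat[OF assms T_F[OF that], of v] T_fv[OF that] N2 that
    by (auto simp: Mod_def)
  then show ?thesis using N1 unfolding Mod_def by blast
qed

text \<open>The inverse isomorphism embeds \<open>N'\<close> into the model \<open>N\<close> with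
  image the whole universe, which is closed.\<close>

lemma is_iso_Mod:
  assumes "is_iso h N N'" and "N \<in> Mod \<tau> T"
  shows "N' \<in> Mod \<tau> T"
proof (rule embedding_closed_Mod)
  note inv = is_iso_inv[OF assms(1)]
  show "embedding (inv_into (univ N) h) N' N" using is_iso_embedding[OF inv] .
  show "is_struct N'" "voc N' = \<tau>" using inv Mod_struct[OF assms(2)] by (auto simp: is_iso_def)
  have "inv_into (univ N) h ` univ N' = univ N" using inv by (auto simp: is_iso_def bij_betw_def)
  then show "closed_in F N (inv_into (univ N) h ` univ N')"
    using closed_in_univ Mod_struct[OF assms(2)] by metis
qed fact

lemma substruct_defset_Qstruct:
  assumes sub: "substruct N1 N2" and voc: "voc N1 = \<tau>" and Q: "Qstruct M As x ys \<phi> \<psi>s \<in> F"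
    and v: "v ` fv (Qstruct M As x ys \<phi> \<psi>s) \<subseteq> univ N1"
  shows "defset \<phi> x N1 v = defset \<phi> x N2 v \<inter> univ N1"
    and "\<forall>i<length \<psi>s. defset (\<psi>s ! i) (ys ! i) N1 v = defset (\<psi>s ! i) (ys ! i) N2 v \<inter> univ N1"
proof -
  have "v ` (fv \<phi> - {x}) \<subseteq> univ N1" using v unfolding F_Qstruct_fv[OF Q] by blast
  then show "defset \<phi> x N1 v = defset \<phi> x N2 v \<inter> univ N1"
    using F_ok[OF Q] F_Qstruct_qfree[OF Q] voc by (intro substruct_defset[OF sub]) auto
  show "\<forall>i<length \<psi>s. defset (\<psi>s ! i) (ys ! i) N1 v = defset (\<psi>s ! i) (ys ! i) N2 v \<inter> univ N1"
  proof (intro allI impI)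
    fix i assume i: "i < length \<psi>s"
    have "v ` (fv (\<psi>s ! i) - {ys ! i}) \<subseteq> univ N1" using v i unfolding F_Qstruct_fv[OF Q] by blast
    then show "defset (\<psi>s ! i) (ys ! i) N1 v = defset (\<psi>s ! i) (ys ! i) N2 v \<inter> univ N1"
      using F_ok[OF Q] F_Qstruct_qfree[OF Q] voc i by (intro substruct_defset[OF sub]) auto
  qed
qed

text \<open>From left to right, \<open>Mod_defset\<close> supplies the size proviso, so the solution
  sets in N2 equal those in N1. Conversely, closedness leaves no solutions outside N1 and makes all
  formulas of \<open>F\<close> transfer.\<close>

lemma elem_sub_star_iff:
  assumes N1: "N1 \<in> Mod \<tau> T" and N2: "N2 \<in> Mod \<tau> T"
  shows "elem_sub_star \<kappa> F N1 N2 \<longleftrightarrow> substruct N1 N2 \<and> closed_in F N2 (univ N1)"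
proof
  assume *: "elem_sub_star \<kappa> F N1 N2"
  then have sub: "substruct N1 N2" by (simp add: elem_sub_star_def elem_sub_def)
  moreover have "closed_in F N2 (univ N1)"
  proof (rule closed_inI[OF sub])
    fix M As x ys \<phi> \<psi>s v
    assume Q: "Qstruct M As x ys \<phi> \<psi>s \<in> F" "v ` fv (Qstruct M As x ys \<phi> \<psi>s) \<subseteq> univ N1"
    with * Mod_defset(1)[OF N1 Q] have "defset \<phi> x N1 v = defset \<phi> x N2 v"
      "\<forall>i<length \<psi>s. defset (\<psi>s ! i) (ys ! i) N1 v = defset (\<psi>s ! i) (ys ! i) N2 v"
      unfolding elem_sub_star_def by blast+
    moreover have "defset \<chi> y N1 v \<subseteq> univ N1" for \<chi> y by (auto simp: solutions_def)
    ultimately show "defset \<phi> x N2 v \<subseteq> univ N1 \<and>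
      (\<forall>i<length \<psi>s. defset (\<psi>s ! i) (ys ! i) N2 v \<subseteq> univ N1)" by metis
  qed
  ultimately show "substruct N1 N2 \<and> closed_in F N2 (univ N1)" by blast
next
  assume *: "substruct N1 N2 \<and> closed_in F N2 (univ N1)"
  then have sub: "substruct N1 N2" and closed: "closed_in F N2 (univ N1)" by auto
  have "sat \<phi> N1 v = sat \<phi> N2 v" if "\<phi> \<in> F" "v ` fv \<phi> \<subseteq> univ N1" for \<phi> v
    using embedding_closed_sat[OF substruct_embedding[OF sub] Mod_struct[OF N1] N2 _ that] closed
    by simp
  then have elem: "elem_sub F N1 N2" using sub by (simp add: elem_sub_def)
  have D: "defset \<phi> x N1 v = defset \<phi> x N2 v \<and>
      (\<forall>i<length \<psi>s. defset (\<psi>s ! i) (ys ! i) N1 v = defset (\<psi>s ! i) (ys ! i) N2 v)"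
    if Q: "Qstruct M As x ys \<phi> \<psi>s \<in> F" "v ` fv (Qstruct M As x ys \<phi> \<psi>s) \<subseteq> univ N1"
    for M As x ys \<phi> \<psi>s v
    using closed_in_Qstruct[OF closed Q] substruct_defset_Qstruct[OF sub Mod_struct(2)[OF N1] Q]
    by blast
  show "elem_sub_star \<kappa> F N1 N2"
    unfolding elem_sub_star_def by (intro conjI[OF elem] allI impI, elim conjE) (rule D)
qed

definition le :: "('f, 'r, 'a) struct rel" where
  "le = {(N1, N2). N1 \<in> Mod \<tau> T \<and> N2 \<in> Mod \<tau> T \<and> substruct N1 N2 \<and> closed_in F N2 (univ N1)}"

lemma Mod_fragment_eq: "Mod_fragment \<kappa> \<tau> F T = (Mod \<tau> T, le)"
  unfolding Mod_fragment_def le_def by (simp add: elem_sub_star_iff cong: conj_cong)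

text \<open>A closed subset of a model carries a model automatically. Both the intersections and the
  small submodels of the Loewenheim-Skolem-Tarski axiom arise in this way.\<close>

lemma restrict_le:
  assumes "N \<in> Mod \<tau> T" and "closed_in F N B"
  shows "(restrict_struct N B, N) \<in> le"
proof -
  have sub: "substruct (restrict_struct N B) N"
    using Mod_struct(1)[OF assms(1)] assms(2) by (rule restrict_substruct)
  have u: "univ (restrict_struct N B) = B" by (simp add: restrict_struct_def)
  have "restrict_struct N B \<in> Mod \<tau> T"
    using sub assms Mod_struct[OF assms(1)] u
    by (intro embedding_closed_Mod[OF substruct_embedding[OF sub]]) (simp_all add: substruct_def)
  then show ?thesis using assms sub u by (simp add: le_def)
qed

end

section \<open>The axioms of abstract elementary classes\<close>

context forall_Q_fragment
begin

lemma leD: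
  assumes "(N1, N2) \<in> le"
  shows "N1 \<in> Mod \<tau> T" "N2 \<in> Mod \<tau> T" "substruct N1 N2" "closed_in F N2 (univ N1)"
  using assms by (simp_all add: le_def)

lemma le_refl:
  assumes "N \<in> Mod \<tau> T"
  shows "(N, N) \<in> le"
  using assms closed_in_univ Mod_struct(1)[OF assms] by (simp add: le_def substruct_def)

text \<open>Solutions in N3 with parameters from N1 lie in N2, hence are solutions in N2, hence lie
  in N1.\<close>

lemma le_trans:
  assumes "(N1, N2) \<in> le" and "(N2, N3) \<in> le"
  shows "(N1, N3) \<in> le"
proof -
  note 12 = leD[OF assms(1)] and 23 = leD[OF assms(2)]
  have sub: "substruct N1 N3" using substruct_trans 12 23 by blast
  have "closed_in F N3 (univ N1)"
  proof (rule closed_inI[OF sub])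
    fix M As x ys \<phi> \<psi>s v
    assume Q: "Qstruct M As x ys \<phi> \<psi>s \<in> F" and v: "v ` fv (Qstruct M As x ys \<phi> \<psi>s) \<subseteq> univ N1"
    have v2: "v ` fv (Qstruct M As x ys \<phi> \<psi>s) \<subseteq> univ N2"
      using v 12(3) unfolding substruct_def by (blast intro: subset_trans)
    note Q2 = substruct_defset_Qstruct[OF 23(3) Mod_struct(2)[OF 23(1)] Q v2]
      closed_in_Qstruct[OF 23(4) Q v2] closed_in_Qstruct[OF 12(4) Q v]
    then show "defset \<phi> x N3 v \<subseteq> univ N1 \<and>
      (\<forall>i<length \<psi>s. defset (\<psi>s ! i) (ys ! i) N3 v \<subseteq> univ N1)"
      by (simp add: Int_absorb2)
  qed
  then show ?thesis using sub 12 23 by (simp add: le_def)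
qed

text \<open>Solutions in M1 are solutions in M2 by quantifier-freeness, and M0 contains
  those.\<close>

lemma le_coherent:
  assumes "substruct M0 M1" and "(M1, M2) \<in> le" and "(M0, M2) \<in> le"
  shows "(M0, M1) \<in> le"
proof -
  note 12 = leD[OF assms(2)] and 02 = leD[OF assms(3)]
  have "closed_in F M1 (univ M0)"
  proof (rule closed_inI[OF assms(1)])
    fix M As x ys \<phi> \<psi>s v
    assume Q: "Qstruct M As x ys \<phi> \<psi>s \<in> F" and v: "v ` fv (Qstruct M As x ys \<phi> \<psi>s) \<subseteq> univ M0"
    have v1: "v ` fv (Qstruct M As x ys \<phi> \<psi>s) \<subseteq> univ M1"
      using v assms(1) unfolding substruct_def by (blast intro: subset_trans)
    note Q1 = substruct_defset_Qstruct[OF 12(3) Mod_struct(2)[OF 12(1)] Q v1]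
      closed_in_Qstruct[OF 02(4) Q v]
    then show "defset \<phi> x M1 v \<subseteq> univ M0 \<and>
      (\<forall>i<length \<psi>s. defset (\<psi>s ! i) (ys ! i) M1 v \<subseteq> univ M0)"
      by (simp add: le_infI1)
  qed
  then show ?thesis using assms 12 02 by (simp add: le_def)
qed

lemma le_iso:
  assumes MN: "(M, N) \<in> le" and N: "is_iso h N N'" and M: "is_iso h M M'"
  shows "(M', N') \<in> le"
proof -
  note le = leD[OF MN]
  define k where "k = inv_into (univ N) h"
  have k: "is_iso k N' N" using is_iso_inv[OF N] by (simp add: k_def)
  have sub: "univ M \<subseteq> univ N" using le(3) by (simp add: substruct_def)
  have im: "h ` univ M = univ M'" "h ` univ N = univ N'" and inj: "inj_on h (univ N)"
    using N M by (auto simp: is_iso_def bij_betw_def)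
  have kh: "k (h a) = a" if "a \<in> univ N" for a using inj that by (simp add: k_def)
  have hk: "h (k b) = b" if "b \<in> univ N'" for b using that im(2) by (simp add: k_def f_inv_into_f)
  \<comment> \<open>The same \<open>h\<close> serves both isomorphisms, so the inverse on the larger
    universe also carries \<open>univ M'\<close> back to \<open>univ M\<close>.\<close>
  have kM: "k b \<in> univ M" if "b \<in> univ M'" for b
    using that im(1) kh sub by (metis imageE subsetD)
  have struct': "is_struct M'" "is_struct N'" "voc M' = voc N'" "voc M = voc M'" "voc N = voc N'"
    using N M le(3) by (auto simp: is_iso_def substruct_def)
  have sub': "univ M' \<subseteq> univ N'" using sub im by blast
  have map_kM: "set (map k xs) \<subseteq> univ M" "map h (map k xs) = xs" if "set xs \<subseteq> univ M'" for xs
    using that kM hk sub' by (auto simp: subset_iff intro!: map_idI)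
  have subs: "substruct M' N'"
    unfolding substruct_def
  proof (intro conjI allI impI struct' sub'; elim conjE)
    fix f xs assume *: "fun_ar (voc M') f = Some (length xs)" "set xs \<subseteq> univ M'"
    have ar: "fun_ar (voc M) f = Some (length (map k xs))" "fun_ar (voc N) f = Some (length (map k xs))"
      using * struct' by simp_all
    have s: "set (map k xs) \<subseteq> univ N" using map_kM(1)[OF *(2)] sub by blast
    have "fn M' f xs = h (fn M f (map k xs))"
      using M ar(1) map_kM[OF *(2)] unfolding is_iso_def by metis
    also have "\<dots> = h (fn N f (map k xs))"
      using le(3) ar(1) map_kM[OF *(2)] unfolding substruct_def by metis
    also have "\<dots> = fn N' f xs"
      using N ar(2) s map_kM(2)[OF *(2)] unfolding is_iso_def by metis
    finally show "fn M' f xs = fn N' f xs" .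
  next
    fix r xs assume *: "rel_ar (voc M') r = Some (length xs)" "set xs \<subseteq> univ M'"
    have ar: "rel_ar (voc M) r = Some (length (map k xs))" "rel_ar (voc N) r = Some (length (map k xs))"
      using * struct' by simp_all
    have s: "set (map k xs) \<subseteq> univ N" using map_kM(1)[OF *(2)] sub by blast
    have "rl M' r xs = rl M r (map k xs)"
      using M ar(1) map_kM[OF *(2)] unfolding is_iso_def by metis
    also have "\<dots> = rl N r (map k xs)"
      using le(3) ar(1) map_kM[OF *(2)] unfolding substruct_def by metis
    also have "\<dots> = rl N' r xs"
      using N ar(2) s map_kM(2)[OF *(2)] unfolding is_iso_def by metis
    finally show "rl M' r xs = rl N' r xs" .
  qed
  have "closed_in F N' (univ M')"
  proof (rule closed_inI[OF subs])
    fix A As x ys \<phi> \<psi>s v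
    assume Q: "Qstruct A As x ys \<phi> \<psi>s \<in> F" and v: "v ` fv (Qstruct A As x ys \<phi> \<psi>s) \<subseteq> univ M'"
    have voc: "voc N' = \<tau>" using struct' Mod_struct(2)[OF le(2)] by simp
    have "(k \<circ> v) ` fv (Qstruct A As x ys \<phi> \<psi>s) \<subseteq> univ M"
      using v kM by (auto simp del: fv.simps)
    note closed = closed_in_Qstruct[OF le(4) Q this]
    \<comment> \<open>A solution is pulled back by \<open>k\<close> to \<open>N\<close>, where it
      falls into \<open>M\<close>, and \<open>h\<close> returns it to \<open>M'\<close>.\<close>
    have D: "defset \<chi> y N' v \<subseteq> univ M'"
      if "qfree \<chi>" "fm_ok \<kappa> \<tau> \<chi>" "v ` (fv \<chi> - {y}) \<subseteq> univ M'" "defset \<chi> y N (k \<circ> v) \<subseteq> univ M" for \<chi> y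
    proof
      fix b assume b: "b \<in> defset \<chi> y N' v"
      then have bN: "b \<in> univ N'" by (simp add: solutions_def)
      have "v ` (fv \<chi> - {y}) \<subseteq> univ N'" using that(3) sub' by blast
      then have "k ` defset \<chi> y N' v \<subseteq> defset \<chi> y N (k \<circ> v)"
        using embedding_defset[OF is_iso_embedding[OF k] struct'(2) that(1), of \<kappa> v y] that(2) voc by simp
      then have "k b \<in> univ M" using b that(4) by blast
      then show "b \<in> univ M'" using hk[OF bN] im(1) by (metis imageI)
    qed
    have "defset \<phi> x N' v \<subseteq> univ M'"
    proof (rule D)
      show "v ` (fv \<phi> - {x}) \<subseteq> univ M'" using v unfolding F_Qstruct_fv[OF Q] by blast
    qed (use F_Qstruct_qfree[OF Q] F_ok[OF Q] closed in simp_all)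
    moreover have "defset (\<psi>s ! i) (ys ! i) N' v \<subseteq> univ M'" if i: "i < length \<psi>s" for i
    proof (rule D)
      show "v ` (fv (\<psi>s ! i) - {ys ! i}) \<subseteq> univ M'" using v i unfolding F_Qstruct_fv[OF Q] by blast
    qed (use F_Qstruct_qfree[OF Q] F_ok[OF Q] closed i in simp_all)
    ultimately show "defset \<phi> x N' v \<subseteq> univ M' \<and>
      (\<forall>i<length \<psi>s. defset (\<psi>s ! i) (ys ! i) N' v \<subseteq> univ M')" by blast
  qed
  then show ?thesis
    using subs is_iso_Mod[OF N le(2)] is_iso_Mod[OF M le(1)] by (simp add: le_def)
qed

end

section \<open>Unions of chains\<close>

locale struct_chain =
  fixes \<tau> :: "('f, 'r) vocab" and I :: "'o set" and Ms :: "'o \<Rightarrow> ('f, 'r, 'a) struct"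
  assumes nonempty: "I \<noteq> {}"
    and struct: "i \<in> I \<Longrightarrow> is_struct (Ms i)" and voc: "i \<in> I \<Longrightarrow> voc (Ms i) = \<tau>"
    and chain: "i \<in> I \<Longrightarrow> j \<in> I \<Longrightarrow> substruct (Ms i) (Ms j) \<or> substruct (Ms j) (Ms i)"
begin

abbreviation "U \<equiv> union_struct \<tau> I Ms"

lemma univ_U: "univ U = (\<Union>i\<in>I. univ (Ms i))"
  by (simp add: union_struct_def)

text \<open>Here finitariness matters: the arguments of a symbol and the parameters of a formula all
  lie in one member of the chain.\<close>

lemma finite_subset_member:
  assumes "finite X" and "X \<subseteq> univ U"
  obtains i where "i \<in> I" and "X \<subseteq> univ (Ms i)"
proof -
  have "\<exists>i\<in>I. X \<subseteq> univ (Ms i)" using assms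
  proof (induction X)
    case empty
    then show ?case using nonempty by blast
  next
    case (insert a X)
    then obtain i j where i: "i \<in> I" "X \<subseteq> univ (Ms i)" and j: "j \<in> I" "a \<in> univ (Ms j)"
      unfolding univ_U by auto
    have "univ (Ms i) \<subseteq> univ (Ms j) \<or> univ (Ms j) \<subseteq> univ (Ms i)"
      using chain[OF i(1) j(1)] unfolding substruct_def by blast
    then show ?case using i j by blast
  qed
  then show thesis using that by blast
qed

text \<open>Makes the definite description in \<open>union_struct\<close> meaningful, even at wrong
  arities, where every member yields \<open>undefined\<close>.\<close>

lemma fn_member_eq:
  assumes i: "i \<in> I" "set xs \<subseteq> univ (Ms i)" and j: "j \<in> I" "set xs \<subseteq> univ (Ms j)"
  shows "fn (Ms i) f xs = fn (Ms j) f xs"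
proof (cases "fun_ar \<tau> f = Some (length xs)")
  case True
  then show ?thesis
    using chain[OF i(1) j(1)] i j voc[OF i(1)] voc[OF j(1)] unfolding substruct_def by metis
next
  case False
  then have "fn (Ms i) f xs = undefined" "fn (Ms j) f xs = undefined"
    using struct[OF i(1)] struct[OF j(1)] voc[OF i(1)] voc[OF j(1)] unfolding is_struct_def by auto
  then show ?thesis by simp
qed

lemma fn_U:
  assumes i: "i \<in> I" "set xs \<subseteq> univ (Ms i)"
  shows "fn U f xs = fn (Ms i) f xs"
proof -
  have "(THE y. \<exists>j\<in>I. set xs \<subseteq> univ (Ms j) \<and> y = fn (Ms j) f xs) = fn (Ms i) f xs"
    using i fn_member_eq by (intro the_equality) blast+
  moreover have "\<exists>j\<in>I. set xs \<subseteq> univ (Ms j)" using i by blast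
  ultimately show ?thesis by (simp add: union_struct_def)
qed

lemma rl_U:
  assumes i: "i \<in> I" "set xs \<subseteq> univ (Ms i)"
  shows "rl U r xs = rl (Ms i) r xs"
proof -
  have "rl (Ms i) r xs" if j: "j \<in> I" "rl (Ms j) r xs" for j
  proof -
    have "rel_ar \<tau> r = Some (length xs)" "set xs \<subseteq> univ (Ms j)"
      using struct[OF j(1)] voc[OF j(1)] j(2) unfolding is_struct_def by auto
    then show ?thesis
      using chain[OF i(1) j(1)] i j voc[OF i(1)] voc[OF j(1)] unfolding substruct_def by metis
  qed
  then show ?thesis using i by (auto simp: union_struct_def)
qed

lemma voc_U: "voc U = \<tau>"
  by (simp add: union_struct_def)

lemma is_struct_U: "is_struct U"
  unfolding is_struct_def
proof (intro conjI allI impI)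
  fix f xs assume *: "fun_ar (voc U) f = Some (length xs) \<and> set xs \<subseteq> univ U"
  then obtain i where i: "i \<in> I" "set xs \<subseteq> univ (Ms i)"
    using finite_subset_member[of "set xs"] by blast
  then have "fn (Ms i) f xs \<in> univ (Ms i)"
    using * voc struct by (intro fn_closed) (simp_all add: voc_U)
  then show "fn U f xs \<in> univ U" unfolding univ_U fn_U[OF i] using i by blast
next
  fix f xs assume *: "\<not> (fun_ar (voc U) f = Some (length xs) \<and> set xs \<subseteq> univ U)"
  show "fn U f xs = undefined"
  proof (cases "\<exists>i\<in>I. set xs \<subseteq> univ (Ms i)")
    case True
    then obtain i where i: "i \<in> I" "set xs \<subseteq> univ (Ms i)" by blast
    then have "set xs \<subseteq> univ U" unfolding univ_U by blast
    with * have "fun_ar (voc (Ms i)) f \<noteq> Some (length xs)" using voc[OF i(1)] by (simp add: voc_U)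
    then show ?thesis unfolding fn_U[OF i] using struct[OF i(1)] by (simp add: is_struct_def)
  qed (simp add: union_struct_def)
next
  fix r xs assume "rl U r xs"
  then obtain i where i: "i \<in> I" "rl (Ms i) r xs" by (auto simp: union_struct_def)
  then have "rel_ar \<tau> r = Some (length xs)" "set xs \<subseteq> univ (Ms i)"
    using struct[OF i(1)] voc[OF i(1)] unfolding is_struct_def by auto
  then show "rel_ar (voc U) r = Some (length xs)" "set xs \<subseteq> univ U"
    unfolding voc_U univ_U using i by auto
qed

lemma substruct_U: "i \<in> I \<Longrightarrow> substruct (Ms i) U"
  using struct is_struct_U voc fn_U rl_U
  by (auto simp: substruct_def voc_U univ_U)

lemma U_substruct:
  assumes "\<And>i. i \<in> I \<Longrightarrow> substruct (Ms i) N"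
  shows "substruct U N"
proof -
  obtain i where i: "i \<in> I" using nonempty by blast
  have N: "is_struct N" "voc N = \<tau>" using assms[OF i] voc[OF i] by (auto simp: substruct_def)
  show ?thesis
    unfolding substruct_def
  proof (intro conjI allI impI; (elim conjE)?)
    show "univ U \<subseteq> univ N"
      unfolding univ_U by (rule UN_least) (use assms in \<open>simp add: substruct_def\<close>)
  next
    fix f xs assume *: "fun_ar (voc U) f = Some (length xs)" "set xs \<subseteq> univ U"
    then obtain j where j: "j \<in> I" "set xs \<subseteq> univ (Ms j)"
      using finite_subset_member[of "set xs"] by blast
    then show "fn U f xs = fn N f xs"
      using assms[OF j(1)] fn_U[OF j] * voc[OF j(1)] unfolding substruct_def voc_U by metis
  next
    fix r xs assume *: "rel_ar (voc U) r = Some (length xs)" "set xs \<subseteq> univ U"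
    then obtain j where j: "j \<in> I" "set xs \<subseteq> univ (Ms j)"
      using finite_subset_member[of "set xs"] by blast
    then show "rl U r xs = rl N r xs"
      using assms[OF j(1)] rl_U[OF j] * voc[OF j(1)] unfolding substruct_def voc_U by metis
  qed (use N is_struct_U voc_U in simp_all)
qed

end

context forall_Q_fragment
begin

context
  fixes I :: "'o set" and Ms :: "'o \<Rightarrow> ('f, 'r, 'a) struct"
  assumes nonempty: "I \<noteq> {}"
    and chain: "\<And>i j. i \<in> I \<Longrightarrow> j \<in> I \<Longrightarrow> (Ms i, Ms j) \<in> le \<or> (Ms j, Ms i) \<in> le"
begin

lemma chain_Mod: "i \<in> I \<Longrightarrow> Ms i \<in> Mod \<tau> T"
  using chain leD(1) by blast

interpretation U: struct_chain \<tau> I Ms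
  using nonempty chain_Mod chain leD(3) Mod_struct by unfold_locales blast+

text \<open>A solution in the union belongs to some \<open>Ms j\<close>. If \<open>Ms j\<close> is
  above \<open>Ms i\<close>, it is a solution in \<open>Ms j\<close> and closedness there brings it
  down; otherwise \<open>Ms j\<close> is contained in \<open>Ms i\<close>.\<close>

lemma chain_closed:
  assumes i: "i \<in> I"
  shows "closed_in F U.U (univ (Ms i))"
proof (rule closed_inI[OF U.substruct_U[OF i]])
  fix M As x ys \<phi> \<psi>s v
  assume Q: "Qstruct M As x ys \<phi> \<psi>s \<in> F" and v: "v ` fv (Qstruct M As x ys \<phi> \<psi>s) \<subseteq> univ (Ms i)"
  have *: "a \<in> univ (Ms i)"
    if a: "a \<in> defset \<phi> x U.U v \<or> (\<exists>i<length \<psi>s. a \<in> defset (\<psi>s ! i) (ys ! i) U.U v)" for a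
  proof -
    have "a \<in> univ U.U" using a by (auto simp: solutions_def)
    then obtain j where j: "j \<in> I" "a \<in> univ (Ms j)" unfolding U.univ_U by blast
    from chain[OF i j(1)] show ?thesis
    proof
      assume le: "(Ms i, Ms j) \<in> le"
      have vj: "v ` fv (Qstruct M As x ys \<phi> \<psi>s) \<subseteq> univ (Ms j)"
        using v leD(3)[OF le] unfolding substruct_def by (blast intro: subset_trans)
      show ?thesis
        using substruct_defset_Qstruct[OF U.substruct_U[OF j(1)] U.voc[OF j(1)] Q vj]
          closed_in_Qstruct[OF leD(4)[OF le] Q v] a j(2) by blast
    next
      assume "(Ms j, Ms i) \<in> le"
      then show ?thesis using j(2) leD(3) unfolding substruct_def by blast
    qed
  qed
  then show "defset \<phi> x U.U v \<subseteq> univ (Ms i) \<and>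
    (\<forall>k<length \<psi>s. defset (\<psi>s ! k) (ys ! k) U.U v \<subseteq> univ (Ms i))" by blast
qed

text \<open>The values of the quantified variables lie in one member; a disjunct true there stays
  true in the union, as the member is closed in it.\<close>

lemma chain_union_Mod: "U.U \<in> Mod \<tau> T"
proof -
  have "sat \<sigma> U.U v" if \<sigma>: "\<sigma> \<in> T" for \<sigma> v
  proof -
    obtain zs \<Phi> x ys \<phi> \<psi>s where \<sigma>_eq: "\<sigma> = foldr All zs (Disj \<Phi>)" and m: "matrix \<Phi> x ys \<phi> \<psi>s"
      using T_cases[OF \<sigma>] .
    have fv: "fv (Disj \<Phi>) \<subseteq> set zs" using T_fv[OF \<sigma>] unfolding \<sigma>_eq fv_foldr_All by blast
    have "sat (Disj \<Phi>) U.U w" if w: "w ` set zs \<subseteq> univ U.U" for w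
    proof -
      obtain i where i: "i \<in> I" "w ` set zs \<subseteq> univ (Ms i)"
        using U.finite_subset_member[OF _ w] by blast
      have "sat \<sigma> (Ms i) w" using chain_Mod[OF i(1)] \<sigma> by (simp add: Mod_def)
      then have "sat (Disj \<Phi>) (Ms i) w" using i(2) unfolding \<sigma>_eq sat_foldr_All by blast
      then obtain \<theta> where \<theta>: "\<theta> \<in> ran \<Phi>" "sat \<theta> (Ms i) w" unfolding sat_Conj_Disj by blast
      then obtain M As where \<theta>_eq: "\<theta> = Qstruct M As x ys \<phi> \<psi>s" using m by (auto simp: matrix_def)
      have "\<theta> \<in> F" using F_subfm[OF matrix_F, of zs \<Phi> \<theta>] \<sigma> \<sigma>_eq \<theta>(1) by simp
      moreover have "fv \<theta> \<subseteq> fv (Disj \<Phi>)" unfolding fv_Conj_Disj using \<theta>(1) by blast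
      then have "w ` fv \<theta> \<subseteq> univ (Ms i)" using fv i(2) by blast
      ultimately have "sat \<theta> U.U w"
        using embedding_closed_sat_Qstruct[OF substruct_embedding[OF U.substruct_U[OF i(1)]]
            U.struct[OF i(1)] U.voc[OF i(1)] U.is_struct_U U.voc_U, of M As x ys \<phi> \<psi>s w]
          chain_closed[OF i(1)] \<theta>(2) unfolding \<theta>_eq by (simp del: sat.simps fv.simps)
      then show ?thesis using \<theta>(1) unfolding sat_Conj_Disj by blast
    qed
    then show ?thesis unfolding \<sigma>_eq sat_foldr_All by blast
  qed
  then show ?thesis using U.is_struct_U U.voc_U unfolding Mod_def by blast
qed

lemma chain_union_upper: "i \<in> I \<Longrightarrow> (Ms i, U.U) \<in> le"
  using chain_Mod chain_union_Mod U.substruct_U chain_closed by (simp add: le_def)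

text \<open>Finitely many parameters lie in one member, which already contains all their solutions
  in \<open>N\<close>.\<close>

lemma chain_union_least:
  assumes N: "\<And>i. i \<in> I \<Longrightarrow> (Ms i, N) \<in> le"
  shows "(U.U, N) \<in> le"
proof -
  have sub: "substruct U.U N" using N leD(3) by (intro U.U_substruct) blast
  have "closed_in F N (univ U.U)"
  proof (rule closed_inI[OF sub])
    fix M As x ys \<phi> \<psi>s v
    assume Q: "Qstruct M As x ys \<phi> \<psi>s \<in> F" and v: "v ` fv (Qstruct M As x ys \<phi> \<psi>s) \<subseteq> univ U.U"
    have "finite (v ` fv (Qstruct M As x ys \<phi> \<psi>s))" using finite_fv[OF F_ok[OF Q]] by (rule finite_imageI)
    then obtain i where i: "i \<in> I" "v ` fv (Qstruct M As x ys \<phi> \<psi>s) \<subseteq> univ (Ms i)"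
      using v by (rule U.finite_subset_member)
    have "univ (Ms i) \<subseteq> univ U.U" unfolding U.univ_U using i(1) by blast
    then show "defset \<phi> x N v \<subseteq> univ U.U \<and>
      (\<forall>i<length \<psi>s. defset (\<psi>s ! i) (ys ! i) N v \<subseteq> univ U.U)"
      using closed_in_Qstruct[OF leD(4)[OF N[OF i(1)]] Q i(2)] by blast
  qed
  moreover have "N \<in> Mod \<tau> T" using N nonempty leD(2) by blast
  ultimately show ?thesis using sub chain_union_Mod by (simp add: le_def)
qed

end

section \<open>The closure and its size\<close>

text \<open>An equation stands for the operation given by its left-hand side, so that \<open>F\<close> indexes
  all operations under which the closure is taken.\<close>

definition witnesses ::
  "('f, 'r, 'a) struct \<Rightarrow> ('f, 'r, 'k, 'i) fm \<Rightarrow> 'a list \<Rightarrow> 'a set" where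
  "witnesses N \<chi> xs = (case \<chi> of
     Eq s t \<Rightarrow> {tm_val N ((!) xs) s}
   | Qstruct M As x ys \<phi> \<psi>s \<Rightarrow>
       if |defset \<phi> x N ((!) xs)| <o \<kappa> then defset \<phi> x N ((!) xs) else {}
   | _ \<Rightarrow> {})"

text \<open>Intersecting with \<open>univ N\<close> is necessary, since \<open>(!) xs\<close> has
  unspecified values beyond the end of \<open>xs\<close> and term values may therefore leave the
  universe. For parameters in \<open>N\<close> the size guard in \<open>witnesses\<close> is
  satisfied by \<open>Mod_defset\<close>, which also covers the sets defined by the \<psi>s.\<close>

lemma witnesses_closed:
  assumes N: "N \<in> Mod \<tau> T"
    and B: "\<And>\<chi> xs. \<chi> \<in> F \<Longrightarrow> set xs \<subseteq> B \<Longrightarrow> witnesses N \<chi> xs \<subseteq> B"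
  shows "closed_in F N (B \<inter> univ N)"
  unfolding closed_in_def
proof (intro conjI allI impI; (elim conjE)?)
  show "B \<inter> univ N \<subseteq> univ N" by blast
next
  fix f xs assume f: "fun_ar (voc N) f = Some (length xs)" and xs: "set xs \<subseteq> B \<inter> univ N"
  \<comment> \<open>Variable \<open>j\<close> is read as entry \<open>j\<close> of the list, so the
    left-hand term evaluates to \<open>fn N f xs\<close>; the right-hand \<open>Var 0\<close> merely
    completes an atomic formula.\<close>
  let ?\<chi> = "Eq (App f (map Var [0..<length xs])) (Var 0) :: ('f, 'r, 'k, 'i) fm"
  have "?\<chi> \<in> F" using f Mod_struct(2)[OF N] by (intro F_atomic) (auto simp: atomic_def)
  then have "tm_val N ((!) xs) (App f (map Var [0..<length xs])) \<in> B"
    using B[of ?\<chi> xs] xs by (simp add: witnesses_def)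
  moreover have "map (tm_val N ((!) xs)) (map Var [0..<length xs]) = xs"
    by (simp add: comp_def map_nth)
  ultimately have "fn N f xs \<in> B" by (metis tm_val.simps(2))
  moreover have "fn N f xs \<in> univ N" using f xs by (intro fn_closed Mod_struct(1)[OF N]) auto
  ultimately show "fn N f xs \<in> B \<inter> univ N" by blast
next
  fix M As x ys \<phi> \<psi>s v
  assume Q: "Qstruct M As x ys \<phi> \<psi>s \<in> F" (is "?Q \<in> F")
  assume v: "v ` fv ?Q \<subseteq> B \<inter> univ N"
  \<comment> \<open>Parameters must be presented as a list indexed by variable numbers. Without free
    variables \<open>B\<close> may be empty, so only the empty list is available.\<close>
  have "\<exists>xs. set xs \<subseteq> B \<and> (\<forall>z\<in>fv ?Q. xs ! z = v z)"
  proof (cases "fv ?Q = {}")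
    case True
    then show ?thesis by (intro exI[of _ "[]"]) (simp del: fv.simps)
  next
    case False
    then obtain c where c: "c \<in> fv ?Q" by blast
    \<comment> \<open>The length exceeds the largest free variable by one so that this variable is a
      valid index; gaps are padded with a value that is known to be in \<open>B\<close>.\<close>
    let ?xs = "map (\<lambda>z. if z \<in> fv ?Q then v z else v c) [0..<Suc (Max (fv ?Q))]"
    have "z < Suc (Max (fv ?Q))" if "z \<in> fv ?Q" for z
      using Max_ge[OF finite_fv[OF F_ok[OF Q]] that] by simp
    then have "\<forall>z\<in>fv ?Q. ?xs ! z = v z" by (simp del: fv.simps upt_Suc)
    moreover have "set ?xs \<subseteq> B" using v c by (auto simp del: fv.simps)
    ultimately show ?thesis by blast
  qed
  then obtain xs where xs: "set xs \<subseteq> B" "\<forall>z\<in>fv ?Q. xs ! z = v z" by blast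
  have "\<forall>z\<in>fv \<phi> - {x}. xs ! z = v z" using xs(2) unfolding F_Qstruct_fv[OF Q] by blast
  moreover have "fm_ok \<kappa> \<tau> \<phi>" using F_ok[OF Q] by simp
  ultimately have eq: "defset \<phi> x N ((!) xs) = defset \<phi> x N v" by (intro defset_cong)
  have vN: "v ` fv ?Q \<subseteq> univ N" using v by blast
  have "defset \<phi> x N v \<subseteq> B"
    using B[OF Q xs(1)] Mod_defset(1)[OF N Q vN] by (simp add: witnesses_def eq)
  then have \<phi>: "defset \<phi> x N v \<subseteq> B \<inter> univ N" by (auto simp: solutions_def)
  then show "defset \<phi> x N v \<subseteq> B \<inter> univ N" .
  show "defset (\<psi>s ! i) (ys ! i) N v \<subseteq> B \<inter> univ N" if "i < length \<psi>s" for i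
    using Mod_defset(2)[OF N Q vN] \<phi> that by blast
qed

section \<open>The Loewenheim-Skolem-Tarski axiom and number\<close>

lemma Cinfinite_\<kappa>: "Cinfinite \<kappa>"
  using Card_order cinfinite by blast

text \<open>Each symbol is applied to copies of \<open>Var 0\<close> with its own arity; the
  resulting atomic formula lies in \<open>F\<close> and determines the symbol.\<close>

lemma voc_card_ordLeq: "voc_card \<tau> \<le>o |F|"
proof -
  define e :: "'f + 'r \<Rightarrow> ('f, 'r, 'k, 'i) fm" where
    "e s = (case s of Inl f \<Rightarrow> Eq (App f (replicate (the (fun_ar \<tau> f)) (Var 0))) (Var 0)
            | Inr r \<Rightarrow> Rel r (replicate (the (rel_ar \<tau> r)) (Var 0)))" for s
  have "inj_on e (dom (fun_ar \<tau>) <+> dom (rel_ar \<tau>))"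
    by (auto simp: inj_on_def e_def split: sum.splits)
  moreover have "e ` (dom (fun_ar \<tau>) <+> dom (rel_ar \<tau>)) \<subseteq> F"
    by (auto simp: e_def atomic_def intro!: F_atomic)
  ultimately have "|dom (fun_ar \<tau>) <+> dom (rel_ar \<tau>)| \<le>o |F|"
    using card_of_ordLeq by blast
  then show ?thesis by (simp add: voc_card_def csum_def Field_card_of)
qed

lemma LST_axiom_Mod: "LST_axiom \<tau> (Mod \<tau> T, le :: ('f, 'r, 'a) struct rel) ( |F| +c card_pred \<kappa>)"
proof -
  let ?\<mu> = "|F| +c card_pred \<kappa>"
  note pred = card_pred_Cinfinite[OF Cinfinite_\<kappa>]
  have inf: "Cinfinite ?\<mu>" using pred(1) Cinfinite_csum by blast
  \<comment> \<open>The vocabulary is absorbed by \<open>F\<close>, and \<open>natLeq\<close> by the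
    infinite \<open>card_pred \<kappa>\<close>.\<close>
  have "voc_card \<tau> +c natLeq \<le>o ?\<mu>"
    by (intro csum_mono voc_card_ordLeq natLeq_ordLeq_cinfinite pred(1))
  moreover have "\<exists>M\<in>Mod \<tau> T. A \<subseteq> univ M \<and> (M, N) \<in> le \<and> |univ M| \<le>o |A| +c ?\<mu>"
    if N: "N \<in> Mod \<tau> T" and A: "A \<subseteq> univ N" for N :: "('f, 'r, 'a) struct" and A
  proof -
    let ?r = "|A| +c ?\<mu>"
    have r: "Cinfinite ?r" using inf Cinfinite_csum by blast
    have \<mu>r: "?\<mu> \<le>o ?r" using inf by (intro ordLeq_csum2) blast
    have F: "|F| \<le>o ?r" by (rule ordLeq_transitive[OF ordLeq_csum1 \<mu>r]) (rule card_of_Card_order)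
    have pr: "card_pred \<kappa> \<le>o ?r" using pred(1) by (intro ordLeq_transitive[OF ordLeq_csum2 \<mu>r]) blast
    \<comment> \<open>The guard in \<open>witnesses\<close> makes the bound uniform over all lists,
      including those with entries outside \<open>N\<close>.\<close>
    have W: "|witnesses N \<chi> xs| \<le>o ?r" for \<chi> xs
    proof -
      have fin: "|X| \<le>o ?r" if "finite X" for X :: "'a set"
        using finite_ordLess_Cinfinite[OF that r] ordLess_imp_ordLeq by blast
      have small: "|X| \<le>o ?r" if "|X| <o \<kappa>" for X :: "'a set"
        using pred(2)[OF that] pr ordLeq_transitive by blast
      show ?thesis by (cases \<chi>) (auto simp: witnesses_def fin small)
    qed
    obtain B where B: "A \<subseteq> B" "|B| \<le>o ?r"
      "\<And>\<chi> xs. \<chi> \<in> F \<Longrightarrow> set xs \<subseteq> B \<Longrightarrow> witnesses N \<chi> xs \<subseteq> B"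
    proof (rule closure_ordLeq[where g = "witnesses N", OF r ordLeq_csum1[OF card_of_Card_order] F W])
      fix B assume "A \<subseteq> B" "|B| \<le>o ?r" "\<And>\<chi> xs. \<chi> \<in> F \<Longrightarrow> set xs \<subseteq> B \<Longrightarrow> witnesses N \<chi> xs \<subseteq> B"
      then show thesis by (rule that)
    qed
    let ?M = "restrict_struct N (B \<inter> univ N)"
    have u: "univ ?M = B \<inter> univ N" by (simp add: restrict_struct_def)
    have le: "(?M, N) \<in> le" using restrict_le[OF N witnesses_closed[OF N B(3)]] .
    have "|univ ?M| \<le>o |B|" unfolding u by (rule card_of_mono1) blast
    then have "|univ ?M| \<le>o ?r" using B(2) by (rule ordLeq_transitive)
    moreover have "A \<subseteq> univ ?M" unfolding u using A B(1) by blast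
    ultimately show ?thesis using le leD(1)[OF le] by blast
  qed
  ultimately show ?thesis using inf unfolding LST_axiom_def by blast
qed

text \<open>Any non-empty set of cardinal orders on one type has a least member. The sum type is the
  one on which the bound \<open>|F| +c card_pred \<kappa>\<close> lives.\<close>

lemma LST_number_Mod:
  "\<exists>\<mu> :: (('f, 'r, 'k, 'i) fm + 'k) rel.
    is_LST_number \<tau> (Mod \<tau> T, le :: ('f, 'r, 'a) struct rel) \<mu> \<and> \<mu> \<le>o |F| +c card_pred \<kappa>"
proof -
  let ?K = "(Mod \<tau> T, le :: ('f, 'r, 'a) struct rel)"
  let ?L = "{\<mu> :: (('f, 'r, 'k, 'i) fm + 'k) rel. LST_axiom \<tau> ?K \<mu>}"
  have "\<forall>\<mu>\<in>?L. Card_order \<mu>" by (simp add: LST_axiom_def)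
  moreover have L: "|F| +c card_pred \<kappa> \<in> ?L" using LST_axiom_Mod by (rule CollectI)
  ultimately obtain \<mu> where "\<mu> \<in> ?L" and min: "\<forall>\<mu>'\<in>?L. \<mu> \<le>o \<mu>'"
    using exists_minim_Card_order[of ?L] by blast
  then have "is_LST_number \<tau> ?K \<mu>" by (simp add: is_LST_number_def)
  moreover have "\<mu> \<le>o |F| +c card_pred \<kappa>" using min L by (rule bspec)
  ultimately show ?thesis by blast
qed

text \<open>The intersected family contains \<open>univ N\<close> and consists of closed sets, so
  its intersection is closed and carries a model.\<close>

lemma has_intersections_Mod: "has_intersections (Mod \<tau> T, le)"
proof -
  have *: "(cl (Mod \<tau> T, le) N A, N) \<in> le" if N: "N \<in> Mod \<tau> T" and A: "A \<subseteq> univ N" for N A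
  proof -
    have "closed_in F N (\<Inter>{univ N0 | N0. (N0, N) \<in> le \<and> A \<subseteq> univ N0})"
    proof (rule closed_in_Inter)
      show "{univ N0 | N0. (N0, N) \<in> le \<and> A \<subseteq> univ N0} \<noteq> {}" using le_refl[OF N] A by blast
    qed (use leD(4) in blast)
    then show ?thesis using restrict_le[OF N] by (simp add: cl_def)
  qed
  show ?thesis by (simp add: has_intersections_def *)
qed

lemma basic_axioms_Mod: "basic_axioms \<tau> (Mod \<tau> T, le)"
proof -
  have "partial_order_on (Mod \<tau> T) le"
    unfolding partial_order_on_def preorder_on_def
  proof (intro conjI)
    show "le \<subseteq> Mod \<tau> T \<times> Mod \<tau> T" by (auto simp: le_def)
    show "refl_on (Mod \<tau> T) le" by (simp add: refl_on_def le_refl)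
    show "trans le" using le_trans by (rule transI)
    show "antisym le" using substruct_antisym leD(3) by (intro antisymI) blast
  qed
  then show ?thesis
    unfolding basic_axioms_def prod.case
    by (intro conjI allI ballI impI; (elim conjE)?)
      (assumption | (rule Mod_struct leD(3), assumption) |
        (rule is_iso_Mod, assumption, assumption) | (rule le_iso, assumption, assumption, assumption))+
qed

lemma chain_axioms_Mod:
  assumes "limit_ordinal \<delta>"
  shows "chain_axioms \<tau> \<delta> (Mod \<tau> T, le)"
proof -
  have \<delta>: "wo_rel \<delta>" "Field \<delta> \<noteq> {}" using assms by (auto simp: limit_ordinal_def wo_rel_def)
  have total: "(i, j) \<in> \<delta> \<or> (j, i) \<in> \<delta>" if "i \<in> Field \<delta>" "j \<in> Field \<delta>" for i j
    using wo_rel.TOTALS[OF \<delta>(1)] that by blast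
  show ?thesis
    unfolding chain_axioms_def prod.case Let_def
  proof (intro allI impI conjI ballI)
    fix Ms assume "\<forall>i j. (i, j) \<in> \<delta> \<longrightarrow> (Ms i, Ms j) \<in> le"
    then have chain: "(Ms i, Ms j) \<in> le \<or> (Ms j, Ms i) \<in> le"
      if "i \<in> Field \<delta>" "j \<in> Field \<delta>" for i j using total[OF that] by blast
    show "union_struct \<tau> (Field \<delta>) Ms \<in> Mod \<tau> T"
      using chain_union_Mod[where Ms = Ms, OF \<delta>(2) chain] .
    show "(Ms i, union_struct \<tau> (Field \<delta>) Ms) \<in> le" if "i \<in> Field \<delta>" for i
      using chain_union_upper[where Ms = Ms, OF \<delta>(2) chain that] .
    show "(union_struct \<tau> (Field \<delta>) Ms, N) \<in> le" if "\<forall>i\<in>Field \<delta>. (Ms i, N) \<in> le" for N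
      using chain_union_least[where Ms = Ms, OF \<delta>(2) chain] that by blast
  qed
qed

end

theorem theorem3p2:
  fixes \<kappa> :: "'k rel"
    and \<tau> :: "('f, 'r) vocab"
    and T F :: "('f, 'r, 'k, 'i) fm set"
    and \<K> :: "('f, 'r, 'a) struct_class"
  assumes "Card_order \<kappa>" and "cinfinite \<kappa>"
    and "forall_Q_theory \<kappa> \<tau> T"
    and "smallest_fragment \<kappa> \<tau> T F"
    and "\<K> = Mod_fragment \<kappa> \<tau> F T"
  shows "AEC TYPE('o) TYPE(('f, 'r, 'k, 'i) fm + 'k) \<tau> \<K>
    \<and> has_intersections \<K>
    \<and> (\<exists>\<mu> :: (('f, 'r, 'k, 'i) fm + 'k) rel.
           is_LST_number \<tau> \<K> \<mu> \<and> \<mu> \<le>o |F| +c card_pred \<kappa>)"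
proof -
  interpret forall_Q_fragment \<kappa> \<tau> T F by unfold_locales fact+
  have \<K>: "\<K> = (Mod \<tau> T, le)" using assms(5) Mod_fragment_eq by simp
  have "coherence \<K>" unfolding \<K> coherence_def using le_coherent by blast
  then show ?thesis
    using basic_axioms_Mod chain_axioms_Mod LST_axiom_Mod has_intersections_Mod LST_number_Mod unfolding AEC_def \<K> by blast
qed

end
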